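(* Let $N\ge 1$ be an integer. The number of partitions of $N$ in which every part is either equal to $5$ or congruent to $2$ or $3$ modulo $5$, and no part equals $3$, is equal to the number of partitions $\lambda\in\mathsf{Diff_2}^*$ of $N$ such that one of the following holds: (1) $\lambda$ has exactly one part, and $\lambda\neq (3)$; (2) $\lambda$ has exactly two parts, and the number of $1$'s in $col^*(\lambda)$ is congruent to $1$, $2$, or $4$ modulo $5$; (3) $\lambda$ has at least three parts, and $col^*(\lambda)$ has at least as many $2$'s as $3$'s.
   Context: Partitions are written with weakly decreasing positive parts. $\mathsf{Diff_2}$ is the set of partitions $\lambda=(\lambda_1,\dots,\lambda_m)$ whose consecutive differences are at least two, i.e. $\lambda_i-\lambda_{i+1}\ge 2$ for $1\le i<m$. $\mathsf{Diff_2}^*$ is the subset of those partitions in $\mathsf{Diff_2}$ with no part equal to $1$. For $\lambda=(\lambda_1,\dots,\lambda_m)\in\mathsf{Diff_2}^*$, $col^*(\lambda)$ is the partition formed by the columns of (i.e. the conjugate of) $(\lambda_1-2m,\lambda_2-2(m-1),\dots,\lambda_m-2)$, where zero entries are ignored. Example: $col^*((13,10,6,4))=(5,4,2,2)^T=(4,4,2,2,1)$. *)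

theory Defs
  imports Main
begin

definition is_partition :: "nat list \<Rightarrow> bool" where
  "is_partition xs \<longleftrightarrow> sorted_wrt (\<ge>) xs \<and> (\<forall>p\<in>set xs. 0 < p)"

definition partitions_of :: "nat \<Rightarrow> nat list set" where
  "partitions_of N = {xs. is_partition xs \<and> sum_list xs = N}"

definition Diff2 :: "nat list set" where
  "Diff2 = {xs. is_partition xs \<and> (\<forall>i. Suc i < length xs \<longrightarrow> xs ! Suc i + 2 \<le> xs ! i)}"

definition Diff2_star :: "nat list set" where
  "Diff2_star = {xs \<in> Diff2. 1 \<notin> set xs}"

(* The j-th column of the Ferrers diagram has as many cells as there are entries
   that are at least j.  Zero entries of the argument contribute to no column. *)
definition conjugate :: "nat list \<Rightarrow> nat list" where
  "conjugate xs = map (\<lambda>j. length (filter (\<lambda>p. j \<le> p) xs)) [1..<Suc (foldr max xs 0)]"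

(* With 0-based list indices, the entry at position i is lowered by 2 * (m - i),
   where m is the length.  On Diff2_star this subtraction on nat never truncates
   (see Diff2_star_nth_ge). *)
definition col_star :: "nat list \<Rightarrow> nat list" where
  "col_star xs = conjugate (map (\<lambda>i. xs ! i - 2 * (length xs - i)) [0..<length xs])"

lemma Diff2_star_nth_ge:
  assumes "xs \<in> Diff2_star" "i < length xs"
  shows "2 * (length xs - i) \<le> xs ! i"
  using assms(2)
proof (induction "length xs - i" arbitrary: i rule: less_induct)
  case less
  show ?case
  proof (cases "Suc i < length xs")
    case True
    have "2 * (length xs - Suc i) \<le> xs ! Suc i"
      using less True by auto
    moreover have "xs ! Suc i + 2 \<le> xs ! i"
      using assms(1) True by (auto simp: Diff2_star_def Diff2_def)
    ultimately show ?thesis using less(2) by linarith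
  next
    case False
    have "xs ! i \<in> set xs" using less(2) by simp
    then have "0 < xs ! i" "xs ! i \<noteq> 1"
      using assms(1) by (auto simp: Diff2_star_def Diff2_def is_partition_def)
    with False less(2) show ?thesis by linarith
  qed
qed

lemma col_star_example: "col_star [13, 10, 6, 4] = [4, 4, 2, 2, 1]"
  by (simp add: col_star_def conjugate_def upt_rec)

lemma finite_partitions_of: "finite (partitions_of N)"
proof (rule finite_subset)
  have len: "length xs \<le> sum_list xs" if "\<forall>p\<in>set xs. 0 < p" for xs :: "nat list"
    using that by (induction xs) fastforce+
  show "partitions_of N \<subseteq> {xs. set xs \<subseteq> {..N} \<and> length xs \<le> N}"
    using len by (auto simp: partitions_of_def is_partition_def intro: member_le_sum_list)
qed (simp add: finite_lists_length_le)

end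

(* For a partition in Diff2_star with m parts, col_star is an arbitrary partition with parts in
   {1..m} and the size drops by m (m + 1).  Hence, with (q)_m = (1 - q) ... (1 - q^m), the
   partitions with m parts are counted by q^(m (m + 1)) / (q)_m, and their total is the sum side
   of the second Rogers-Ramanujan identity, whose product side counts partitions into parts
   congruent to 2 or 3 mod 5.  Forbidding the part 3 and allowing the part 5 multiplies the
   product by (1 - q^3) / (1 - q^5).  For m >= 3 the condition on the columns does the same to
   each term: pairing every 3 with a 2 replaces the factor for the part 3 by one for a part 5.
   What is left is an identity between the terms with m <= 2.

   The Rogers-Ramanujan identity: both G_k = sum_m q^(m^2 + k m) / (q)_m and an alternating theta
   type sum divided by the infinite product (q)_oo satisfy F_k = F_(k+1) + q^(k+1) F_(k+2) and
   tend to 1 as k grows, so they agree.  At k = 1 the alternating sum is a case of the Jacobi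
   triple product, obtained from the q-binomial theorem.  All limits are replaced by congruences
   modulo powers of q. *)

theory Submission
  imports Defs "HOL-Computational_Algebra.Formal_Power_Series" "HOL-Library.Multiset"
begin

section \<open>Congruence of power series modulo powers of \<open>fps_X\<close>\<close>

definition fcong :: "nat \<Rightarrow> rat fps \<Rightarrow> rat fps \<Rightarrow> bool" where
  "fcong M f g \<longleftrightarrow> fps_X ^ M dvd f - g"

lemma fcong_refl [simp]: "fcong M f f"
  by (simp add: fcong_def)

lemma fcong_sym: "fcong M f g \<Longrightarrow> fcong M g f"
  by (simp add: fcong_def dvd_diff_commute)

lemma fcong_trans: "fcong M f g \<Longrightarrow> fcong M g h \<Longrightarrow> fcong M f h"
  using dvd_add[of "fps_X ^ M" "f - g" "g - h"] by (simp add: fcong_def)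

lemma fcong_add: "fcong M f g \<Longrightarrow> fcong M f' g' \<Longrightarrow> fcong M (f + f') (g + g')"
  using dvd_add[of "fps_X ^ M" "f - g" "f' - g'"] by (simp add: fcong_def algebra_simps)

lemma fcong_diff: "fcong M f g \<Longrightarrow> fcong M f' g' \<Longrightarrow> fcong M (f - f') (g - g')"
  using dvd_diff[of "fps_X ^ M" "f - g" "f' - g'"] by (simp add: fcong_def algebra_simps)

lemma fcong_mult_left: "fcong M f g \<Longrightarrow> fcong M (h * f) (h * g)"
  by (auto simp: fcong_def simp flip: right_diff_distrib)

lemma fcong_mult:
  assumes "fcong M f g" "fcong M f' g'"
  shows "fcong M (f * f') (g * g')"
  using fcong_trans[OF fcong_mult_left[OF assms(2), of f] fcong_mult_left[OF assms(1), of g', unfolded mult.commute[of g']]] .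

lemma fcong_sum: "(\<And>i. i \<in> A \<Longrightarrow> fcong M (f i) (g i)) \<Longrightarrow> fcong M (sum f A) (sum g A)"
  by (induction A rule: infinite_finite_induct) (auto intro: fcong_add)

lemma fcong_mono: "fcong M f g \<Longrightarrow> K \<le> M \<Longrightarrow> fcong K f g"
  unfolding fcong_def by (rule dvd_trans[OF le_imp_power_dvd])

lemma fcong_X_power_0: "M \<le> k \<Longrightarrow> fcong M (fps_X ^ k * f) 0"
  by (simp add: fcong_def dvd_mult2 le_imp_power_dvd)

text \<open>A factor \<open>fps_X ^ k\<close> gains \<open>k\<close> orders of precision; in the
  triple product this makes up for the precision that the outer q-binomials lose.\<close>

lemma fcong_X_power_mult: "fcong M f g \<Longrightarrow> fcong (k + M) (fps_X ^ k * f) (fps_X ^ k * g)"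
  by (auto simp: fcong_def power_add simp flip: right_diff_distrib intro: mult_dvd_mono)

text \<open>A series over a field with nonzero constant coefficient is invertible.\<close>

lemma fcong_cancel:
  assumes "fcong M (u * f) (u * g)" "fps_nth u 0 \<noteq> 0"
  shows "fcong M f g"
proof -
  have "fcong M (inverse u * (u * f)) (inverse u * (u * g))"
    by (rule fcong_mult_left) fact
  then show ?thesis
    using inverse_mult_eq_1[OF assms(2)] by (simp flip: mult.assoc)
qed

lemma fcong_nth:
  assumes "fcong M f g" "i < M"
  shows "fps_nth f i = fps_nth g i"
proof -
  obtain h where "f - g = fps_X ^ M * h"
    using assms(1) by (auto simp: fcong_def)
  then have "fps_nth (f - g) i = 0"
    using assms(2) by (simp add: fps_X_power_mult_nth)
  then show ?thesis by simp
qed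

section \<open>The q-factorials (q)_n, for an arbitrary base q\<close>

definition qfact :: "'a::comm_ring_1 \<Rightarrow> nat \<Rightarrow> 'a" where
  "qfact q n = (\<Prod>i=1..n. 1 - q ^ i)"

lemma qfact_0 [simp]: "qfact q 0 = 1"
  by (simp add: qfact_def)

lemma qfact_Suc: "qfact q (Suc n) = qfact q n * (1 - q ^ Suc n)"
  by (simp add: qfact_def)

lemma qfact_X_power_nth_0:
  "0 < s \<Longrightarrow> fps_nth (qfact (fps_X ^ s :: rat fps) n) 0 = 1"
  by (induction n) (simp_all add: qfact_Suc fps_X_power_nth flip: power_mult power_Suc power_add)

text \<open>Every additional factor is \<open>1 - fps_X ^ (s * i)\<close> with \<open>i > n\<close>,
  hence 1 modulo \<open>fps_X ^ (s * (n + 1))\<close>.\<close>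

lemma fcong_qfact:
  assumes "0 < s" "n \<le> l"
  shows "fcong (s * (n + 1)) (qfact (fps_X ^ s) l) (qfact (fps_X ^ s) n)"
  using assms(2)
proof (induction l rule: dec_induct)
  case base
  show ?case by simp
next
  case (step l)
  have *: "fcong (s * (n + 1)) (fps_X ^ (s * Suc l) * qfact (fps_X ^ s) l) 0"
    by (rule fcong_X_power_0) (use step in auto)
  have "qfact (fps_X ^ s) (Suc l) = qfact (fps_X ^ s) l - fps_X ^ (s * Suc l) * qfact (fps_X ^ s :: rat fps) l"
    by (simp only: qfact_Suc power_mult) (simp add: algebra_simps)
  then show ?case
    using fcong_diff[OF step.IH *] by (simp only: diff_zero)
qed

section \<open>The Rogers--Ramanujan recurrence\<close>

text \<open>The series G_k cut after \<open>M\<close> terms. The omitted terms have exponent at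
  least \<open>M\<close>, so \<open>M\<close> can also serve as the modulus.\<close>

definition rr_sum :: "nat \<Rightarrow> nat \<Rightarrow> rat fps" where
  "rr_sum M k = (\<Sum>m<M. fps_X ^ (m * m + k * m) * inverse (qfact fps_X m))"

lemma qfact_X_nth_0 [simp]: "fps_nth (qfact (fps_X :: rat fps) n) 0 = 1"
  using qfact_X_power_nth_0[of 1 n] by simp

lemma inverse_qfact_Suc:
  "(1 - fps_X ^ Suc n) * inverse (qfact (fps_X :: rat fps) (Suc n)) = inverse (qfact fps_X n)"
proof -
  have "(1 - fps_X ^ Suc n) * inverse (1 - fps_X ^ Suc n) = (1 :: rat fps)"
    by (rule inverse_mult_eq_1') simp
  then show ?thesis
    by (simp add: qfact_Suc fps_inverse_mult mult.left_commute del: power_Suc)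
qed

text \<open>Subtracting term by term produces the factor \<open>1 - fps_X ^ m\<close>, which kills
  the term for 0 and cancels the last factor of (q)_m. Shifting \<open>m\<close> by one then turns
  the exponent into \<open>(k + 1) + m * m + (k + 2) * m\<close>, and the sum loses one
  term.\<close>

lemma rr_sum_rec_exact:
  "rr_sum (Suc M) k - rr_sum (Suc M) (k + 1) = fps_X ^ (k + 1) * rr_sum M (k + 2)"
proof -
  have "rr_sum (Suc M) k - rr_sum (Suc M) (k + 1)
      = (\<Sum>m<Suc M. fps_X ^ (m * m + k * m) * (1 - fps_X ^ m) * inverse (qfact fps_X m))"
    by (simp add: rr_sum_def flip: sum_subtractf del: sum.lessThan_Suc)
       (intro sum.cong refl, simp add: algebra_simps power_add)
  also have "\<dots> = (\<Sum>m<M. fps_X ^ (Suc m * Suc m + k * Suc m) *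
                     ((1 - fps_X ^ Suc m) * inverse (qfact fps_X (Suc m))))"
    by (subst sum.lessThan_Suc_shift) (simp add: mult.assoc del: power_Suc mult_Suc mult_Suc_right)
  also have "\<dots> = fps_X ^ (k + 1) * rr_sum M (k + 2)"
    unfolding inverse_qfact_Suc rr_sum_def sum_distrib_left
    by (intro sum.cong refl) (simp add: algebra_simps power_add)
  finally show ?thesis .
qed

text \<open>The term lost in the exact recurrence has exponent at least \<open>M\<close>.\<close>

lemma rr_sum_rec:
  "fcong M (rr_sum M k) (rr_sum M (k + 1) + fps_X ^ (k + 1) * rr_sum M (k + 2))"
proof (cases M)
  case 0
  then show ?thesis by (simp add: fcong_def)
next
  case (Suc L)
  have "fcong M (fps_X ^ (k + 1 + (L * L + (k + 2) * L)) * inverse (qfact fps_X L)) 0"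
    by (rule fcong_X_power_0) (simp add: Suc algebra_simps)
  from fcong_add[OF fcong_refl this, of "fps_X ^ (k + 1) * rr_sum L (k + 2)"]
  have "fcong M (fps_X ^ (k + 1) * rr_sum (Suc L) (k + 2)) (fps_X ^ (k + 1) * rr_sum L (k + 2))"
    by (simp add: rr_sum_def distrib_left power_add mult.assoc)
  from fcong_add[OF fcong_refl fcong_sym[OF this], of "rr_sum M (k + 1)"]
  show ?thesis using rr_sum_rec_exact[of L k] by (simp add: Suc algebra_simps)
qed

text \<open>All terms except the one for \<open>m = 0\<close> have exponent at least
  \<open>k\<close>.\<close>

lemma rr_sum_lim:
  assumes "M \<le> k"
  shows "fcong M (rr_sum M k) 1"
proof (cases M)
  case 0
  then show ?thesis by (simp add: fcong_def)
next
  case (Suc L)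
  have "fcong M (\<Sum>m<L. fps_X ^ (Suc m * Suc m + k * Suc m) * inverse (qfact fps_X (Suc m)))
               (\<Sum>m<L. 0)"
    by (intro fcong_sum fcong_X_power_0) (use assms in \<open>auto simp: algebra_simps\<close>)
  from fcong_add[OF fcong_refl this, of 1]
  show ?thesis
    unfolding rr_sum_def Suc sum.lessThan_Suc_shift by simp
qed

section \<open>The alternating sum and its recurrence\<close>

text \<open>This is n(5n-1)/2, written as a sum to avoid halving.\<close>

definition rr_exp :: "nat \<Rightarrow> nat" where
  "rr_exp n = (\<Sum>i<n. 5 * i + 2)"

lemma rr_exp_simps [simp]: "rr_exp 0 = 0" "rr_exp (Suc n) = rr_exp n + 5 * n + 2"
  by (simp_all add: rr_exp_def)

lemma rr_exp_ge: "2 * n \<le> rr_exp n"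
  by (induction n) auto

text \<open>A term of the numerator of F_k. For positive \<open>k\<close> the last product is
  (q)_(n+k-1) / (q)_n; at \<open>k = 1\<close> it is empty and a theta series with two monomials per
  term remains.\<close>

definition rr_term :: "nat \<Rightarrow> nat \<Rightarrow> rat fps" where
  "rr_term k n = (- 1) ^ n * fps_X ^ (2 * k * n + rr_exp n) * (1 - fps_X ^ (k + 2 * n)) *
     (\<Prod>i=1..<k. 1 - fps_X ^ (n + i))"

text \<open>With \<open>x = q ^ k\<close> and \<open>Q = q ^ n\<close>, the factor \<open>1 + Q - x * Q ^ 2\<close>
  comes from solving the telescoping equation below with an unknown quadratic polynomial in \<open>Q\<close>.\<close>

definition rr_tele :: "nat \<Rightarrow> nat \<Rightarrow> rat fps" where
  "rr_tele k n = (- 1) ^ n * fps_X ^ (2 * k * n + rr_exp n) * (1 + fps_X ^ n - fps_X ^ (k + 2 * n)) *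
     (\<Prod>i<k. 1 - fps_X ^ (n + i))"

text \<open>The telescoping equation after the common factor \<open>c\<close> is taken out and
  \<open>x\<close>, \<open>Q\<close> stand for q^k, q^n. Without symbolic exponents it is a plain
  polynomial identity.\<close>

lemma rr_polynomial_identity:
  fixes c x q Q :: "'a::comm_ring_1"
  shows "c * (1 - x * Q ^ 2) - c * Q ^ 2 * (1 - x * Q) * (1 - x * q * Q ^ 2)
    - x * q * (c * Q ^ 4 * (1 - x * Q) * (1 - x * q * Q) * (1 - x * q ^ 2 * Q ^ 2))
    = c * (1 - Q) * (1 + Q - x * Q ^ 2)
    - (- c * x ^ 2 * q ^ 2 * Q ^ 5 * (1 - x * Q) * (1 + q * Q - x * q ^ 2 * Q ^ 2))"
  by (simp add: algebra_simps eval_nat_numeral)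

lemma rr_term_telescope:
  assumes "0 < k"
  shows "rr_term k n - rr_term (k + 1) n - fps_X ^ (k + 1) * rr_term (k + 2) n
       = rr_tele k n - rr_tele k (Suc n)"
proof -
  define p :: "rat fps" where "p = (\<Prod>i=1..<k. 1 - fps_X ^ (n + i))"
  define c :: "rat fps" where "c = (- 1) ^ n * fps_X ^ (2 * k * n + rr_exp n) * p"
  define Q :: "rat fps" where "Q = fps_X ^ n"
  define x :: "rat fps" where "x = fps_X ^ k"
  define q :: "rat fps" where "q = fps_X"
  have p1: "(\<Prod>i=1..<k+1. 1 - fps_X ^ (n + i)) = p * (1 - x * Q)"
    using assms by (simp add: p_def x_def Q_def power_add mult_ac)
  have p2: "(\<Prod>i=1..<k+2. 1 - fps_X ^ (n + i)) = p * (1 - x * Q) * (1 - x * q * Q)"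
    using assms by (simp add: p_def x_def Q_def q_def power_add mult_ac)
  have p3: "(\<Prod>i<k. 1 - fps_X ^ (n + i)) = (1 - Q) * p"
    using assms unfolding p_def Q_def lessThan_atLeast0
    by (subst prod.atLeast_Suc_lessThan) auto
  have p4: "(\<Prod>i<k. 1 - fps_X ^ (Suc n + i)) = p * (1 - x * Q)"
    using p1 prod.shift_bounds_Suc_ivl[of "\<lambda>i. 1 - fps_X ^ (n + i) :: rat fps" 0 k]
    by (simp add: lessThan_atLeast0)
  let ?E = "2 * k * n + rr_exp n"
  \<comment> \<open>All exponents are expressed relative to \<open>?E\<close>. Passing from
    \<open>n\<close> to \<open>Suc n\<close> adds \<open>2 * k + 5 * n + 2\<close>, which is the
    monomial \<open>x ^ 2 * q ^ 2 * Q ^ 5\<close>.\<close>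
  have X: "fps_X ^ (2 * (k + 1) * n + rr_exp n) = fps_X ^ ?E * Q ^ 2"
    "fps_X ^ (2 * (k + 2) * n + rr_exp n) = fps_X ^ ?E * Q ^ 4"
    "fps_X ^ (2 * k * Suc n + rr_exp (Suc n)) = fps_X ^ ?E * (x ^ 2 * q ^ 2 * Q ^ 5)"
    "fps_X ^ (k + 2 * n) = x * Q ^ 2"
    "fps_X ^ (k + 1 + 2 * n) = x * q * Q ^ 2"
    "fps_X ^ (k + 2 + 2 * n) = x * q ^ 2 * Q ^ 2"
    "fps_X ^ (k + 2 * Suc n) = x * q ^ 2 * Q ^ 2"
    "fps_X ^ Suc n = q * Q"
    by (simp_all add: x_def Q_def q_def algebra_simps flip: power_mult power_add power_Suc)
  have t0: "rr_term k n = c * (1 - x * Q ^ 2)"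
    unfolding rr_term_def X c_def p_def by (simp only: mult_ac)
  have t1: "rr_term (k + 1) n = c * Q ^ 2 * (1 - x * Q) * (1 - x * q * Q ^ 2)"
    unfolding rr_term_def p1 X c_def by (simp only: mult_ac)
  have t2: "rr_term (k + 2) n = c * Q ^ 4 * (1 - x * Q) * (1 - x * q * Q) * (1 - x * q ^ 2 * Q ^ 2)"
    unfolding rr_term_def p2 X c_def by (simp only: mult_ac)
  have d0: "rr_tele k n = c * (1 - Q) * (1 + Q - x * Q ^ 2)"
    unfolding rr_tele_def p3 X c_def Q_def[symmetric] by (simp only: mult_ac)
  have d1: "rr_tele k (Suc n) = - c * x ^ 2 * q ^ 2 * Q ^ 5 * (1 - x * Q) * (1 + q * Q - x * q ^ 2 * Q ^ 2)"
    unfolding rr_tele_def p4 X c_def by simp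
  have e: "fps_X ^ (k + 1) = x * q"
    by (simp add: x_def q_def)
  show ?thesis
    unfolding t0 t1 t2 d0 d1 e by (rule rr_polynomial_identity)
qed

definition rr_alt_sum :: "nat \<Rightarrow> nat \<Rightarrow> rat fps" where
  "rr_alt_sum M k = (\<Sum>n<M. rr_term k n)"

text \<open>The defect of the recurrence telescopes. \<open>rr_tele k 0\<close> vanishes because its
  product contains \<open>1 - fps_X ^ 0\<close>, and \<open>rr_tele k M\<close> is divisible by
  \<open>fps_X ^ M\<close>.\<close>

lemma rr_alt_sum_rec:
  assumes "0 < k"
  shows "fcong M (rr_alt_sum M k) (rr_alt_sum M (k + 1) + fps_X ^ (k + 1) * rr_alt_sum M (k + 2))"
proof -
  have "rr_alt_sum M k - (rr_alt_sum M (k + 1) + fps_X ^ (k + 1) * rr_alt_sum M (k + 2))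
      = (\<Sum>n<M. rr_tele k n - rr_tele k (Suc n))"
    unfolding rr_term_telescope[OF assms, symmetric]
    by (simp add: rr_alt_sum_def sum_subtractf sum_distrib_left)
  also have "\<dots> = rr_tele k 0 - rr_tele k M"
    by (rule sum_lessThan_telescope')
  also have "rr_tele k 0 = 0"
  proof -
    have "(\<Prod>i<k. 1 - fps_X ^ (0 + i)) = (0 :: rat fps)"
      by (rule prod_zero) (use assms in \<open>auto intro!: bexI[of _ 0]\<close>)
    then show ?thesis by (simp only: rr_tele_def mult_zero_right)
  qed
  finally have *: "rr_alt_sum M k - (rr_alt_sum M (k + 1) + fps_X ^ (k + 1) * rr_alt_sum M (k + 2))
      = - rr_tele k M" by simp
  have "M \<le> 2 * k * M + rr_exp M"
    using rr_exp_ge[of M] by simp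
  then have "fps_X ^ M dvd (fps_X ^ (2 * k * M + rr_exp M) :: rat fps)"
    by (rule le_imp_power_dvd)
  then show ?thesis
    unfolding fcong_def * rr_tele_def by (simp add: dvd_mult dvd_mult2)
qed

text \<open>Terms with positive \<open>n\<close> have exponent at least \<open>2 * k\<close>. In the
  term for \<open>n = 0\<close> the factor \<open>1 - fps_X ^ k\<close> completes the product to
  (q)_k.\<close>

lemma rr_alt_sum_lim:
  assumes "M \<le> k" "0 < k"
  shows "fcong M (rr_alt_sum M k) (qfact fps_X k)"
proof (cases M)
  case 0
  then show ?thesis by (simp add: fcong_def)
next
  case (Suc L)
  have "rr_term k 0 = qfact fps_X (Suc (k - 1))"
    using assms by (simp only: rr_term_def qfact_def)
      (simp add: atLeastLessThanSuc_atLeastAtMost flip: atLeastLessThanSuc_atLeastAtMost)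
  then have t: "rr_term k 0 = qfact fps_X k"
    using assms by simp
  have "fcong M (\<Sum>n<L. rr_term k (Suc n)) (\<Sum>n<L. 0)"
  proof (rule fcong_sum)
    fix n
    have "fcong M (fps_X ^ (2 * k * Suc n + rr_exp (Suc n)) * ((- 1) ^ Suc n *
      (1 - fps_X ^ (k + 2 * Suc n)) * (\<Prod>i=1..<k. 1 - fps_X ^ (Suc n + i)))) 0"
      by (rule fcong_X_power_0) (use assms in auto)
    then show "fcong M (rr_term k (Suc n)) 0"
      unfolding rr_term_def by (simp only: mult_ac)
  qed
  from fcong_add[OF fcong_refl this, of "rr_term k 0"]
  show ?thesis
    unfolding rr_alt_sum_def Suc sum.lessThan_Suc_shift by (simp add: t)
qed

text \<open>Both sides satisfy the same recurrence in k and agree to order M for k at least M, so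
  they agree to order M for all positive k.\<close>

lemma rr_alt_sum_eq_rr_sum:
  assumes "M \<le> L" "0 < k"
  shows "fcong M (rr_alt_sum M k) (qfact fps_X L * rr_sum M k)"
  using assms(2)
proof (induction "M - k" arbitrary: k rule: less_induct)
  case less
  show ?case
  proof (cases "M \<le> k")
    case True
    \<comment> \<open>Any \<open>L\<close> from \<open>M\<close> on stands for the infinite product;
      both sides are compared through \<open>qfact fps_X M\<close>.\<close>
    have "fcong M (qfact fps_X L) (qfact fps_X M)"
      using fcong_qfact[of 1 M L] assms(1) by (auto intro: fcong_mono)
    moreover have "fcong M (qfact fps_X k) (qfact fps_X M)"
      using fcong_qfact[of 1 M k] True by (auto intro: fcong_mono)
    ultimately have "fcong M (qfact fps_X k) (qfact fps_X L * 1)"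
      by (auto intro: fcong_trans fcong_sym)
    moreover have "fcong M (qfact fps_X L * rr_sum M k) (qfact fps_X L * 1)"
      by (intro fcong_mult_left rr_sum_lim True)
    ultimately show ?thesis
      using rr_alt_sum_lim[OF True less.prems] by (metis fcong_trans fcong_sym)
  next
    case False
    let ?c = "qfact fps_X L :: rat fps"
    have "fcong M (rr_alt_sum M (k + 1)) (?c * rr_sum M (k + 1))"
      "fcong M (rr_alt_sum M (k + 2)) (?c * rr_sum M (k + 2))"
      using False by (auto intro!: less.hyps)
    then have "fcong M (rr_alt_sum M (k + 1) + fps_X ^ (k + 1) * rr_alt_sum M (k + 2))
       (?c * rr_sum M (k + 1) + fps_X ^ (k + 1) * (?c * rr_sum M (k + 2)))"
      by (intro fcong_add fcong_mult_left)
    also have "?c * rr_sum M (k + 1) + fps_X ^ (k + 1) * (?c * rr_sum M (k + 2))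
      = ?c * (rr_sum M (k + 1) + fps_X ^ (k + 1) * rr_sum M (k + 2))"
      by (simp add: algebra_simps)
    finally show ?thesis
      by (rule fcong_trans[OF rr_alt_sum_rec[OF less.prems]
          fcong_trans[OF _ fcong_sym[OF fcong_mult_left[OF rr_sum_rec]]]])
  qed
qed

section \<open>The q-binomial theorem\<close>

text \<open>Gaussian binomials, by the q-Pascal rule rather than as quotients, so that they exist in
  every commutative ring.\<close>

fun qbin :: "'a::comm_ring_1 \<Rightarrow> nat \<Rightarrow> nat \<Rightarrow> 'a" where
  "qbin q n 0 = 1"
| "qbin q 0 (Suc k) = 0"
| "qbin q (Suc n) (Suc k) = qbin q n k + q ^ Suc k * qbin q n (Suc k)"

lemma qbin_eq_0: "n < k \<Longrightarrow> qbin q n k = 0"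
  by (induction q n k rule: qbin.induct) auto

text \<open>The quotient formula with denominators cleared. For \<open>n = Suc k + l\<close> the two
  induction hypotheses combine through \<open>1 - q ^ Suc n = (1 - q ^ Suc k) + q ^ Suc k * (1 - q ^
  Suc l)\<close>.\<close>

lemma qbin_qfact:
  "k \<le> n \<Longrightarrow> qbin q n k * qfact q k * qfact q (n - k) = qfact q n"
proof (induction q n k rule: qbin.induct)
  case (3 q n k)
  show ?case
  proof (cases "k = n")
    case True
    with 3(1) have "qbin q n n * qfact q n = qfact q n" by simp
    then show ?thesis
      using True by (simp add: qbin_eq_0 qfact_Suc flip: mult.assoc)
  next
    case False
    define l where "l = n - Suc k"
    with False 3(3) have l: "n - k = Suc l" "n = Suc k + l" by auto
    have IH1: "qbin q n k * qfact q k * (qfact q l * (1 - q ^ Suc l)) = qfact q n"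
      using 3(1) l by (simp add: qfact_Suc)
    have IH2: "qbin q n (Suc k) * (qfact q k * (1 - q ^ Suc k)) * qfact q l = qfact q n"
      using 3(2) l by (simp add: qfact_Suc)
    have "qbin q (Suc n) (Suc k) * qfact q (Suc k) * qfact q (Suc n - Suc k)
      = (1 - q ^ Suc k) * (qbin q n k * qfact q k * (qfact q l * (1 - q ^ Suc l)))
      + q ^ Suc k * (1 - q ^ Suc l) * (qbin q n (Suc k) * (qfact q k * (1 - q ^ Suc k)) * qfact q l)"
      using l(1) by (simp add: qfact_Suc algebra_simps)
    also have "\<dots> = qfact q n * (1 - q ^ (Suc k + Suc l))"
      unfolding IH1 IH2 power_add by (simp add: algebra_simps)
    finally show ?thesis using l(2) by (simp add: qfact_Suc)
  qed
qed auto

definition tri :: "nat \<Rightarrow> nat" where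
  "tri n = (\<Sum>i<n. i)"

lemma tri_simps [simp]: "tri 0 = 0" "tri (Suc n) = tri n + n"
  by (simp_all add: tri_def)

lemma tri_add: "tri (m + n) = tri m + tri n + m * n"
  by (induction n) auto

text \<open>Once the factor for \<open>i = 0\<close> is split off, the rest is the case
  \<open>n\<close> with \<open>b * q\<close> for \<open>b\<close>; the coefficients recombine by the
  q-Pascal rule. The form homogeneous in \<open>a\<close> and \<open>b\<close> avoids negative
  powers later.\<close>

theorem q_binomial:
  "(\<Prod>i<n. a + b * q ^ i) = (\<Sum>j\<le>n. qbin q n j * q ^ tri j * a ^ (n - j) * b ^ j)"
proof (induction n arbitrary: b)
  case (Suc n)
  define s where "s j = qbin q n j * q ^ (tri j + j) * a ^ (n - j) * b ^ j" for j
  have "(\<Prod>i<Suc n. a + b * q ^ i) = (a + b) * (\<Prod>i<n. a + (b * q) * q ^ i)"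
    by (simp only: prod.lessThan_Suc_shift) (simp add: mult.assoc)
  also have "\<dots> = (a + b) * (\<Sum>j\<le>n. s j)"
    unfolding Suc.IH s_def by (simp add: power_add power_mult_distrib mult_ac)
  also have "\<dots> = (\<Sum>j\<le>n. a * s j) + (\<Sum>j\<le>n. b * s j)"
    by (simp add: distrib_right sum_distrib_left sum.distrib)
  also have "(\<Sum>j\<le>n. a * s j) = (\<Sum>j\<le>n. qbin q n j * q ^ (tri j + j) * a ^ (Suc n - j) * b ^ j)"
    by (intro sum.cong refl) (simp add: s_def Suc_diff_le mult_ac)
  also have "\<dots> = (\<Sum>j\<le>Suc n. qbin q n j * q ^ (tri j + j) * a ^ (Suc n - j) * b ^ j)"
    by (simp add: qbin_eq_0)
  also have "\<dots> = a ^ Suc n + (\<Sum>j\<le>n. q ^ Suc j * qbin q n (Suc j) * q ^ tri (Suc j) * a ^ (n - j) * b ^ Suc j)"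
    by (subst sum.atMost_Suc_shift) (simp add: power_add mult_ac)
  also have "(\<Sum>j\<le>n. b * s j) = (\<Sum>j\<le>n. qbin q n j * q ^ tri (Suc j) * a ^ (n - j) * b ^ Suc j)"
    by (simp add: s_def mult_ac)
  also have "a ^ Suc n + (\<Sum>j\<le>n. q ^ Suc j * qbin q n (Suc j) * q ^ tri (Suc j) * a ^ (n - j) * b ^ Suc j) + \<dots>
     = a ^ Suc n + (\<Sum>j\<le>n. qbin q (Suc n) (Suc j) * q ^ tri (Suc j) * a ^ (n - j) * b ^ Suc j)"
    by (simp add: sum.distrib[symmetric] algebra_simps)
  also have "\<dots> = (\<Sum>j\<le>Suc n. qbin q (Suc n) j * q ^ tri j * a ^ (Suc n - j) * b ^ j)"
    by (subst sum.atMost_Suc_shift) simp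
  finally show ?case .
qed simp

section \<open>The product side\<close>

lemma rr_exp_tri: "rr_exp n = 5 * tri n + 2 * n"
  by (induction n) auto

lemma double_tri: "2 * tri n + n = n * n"
  by (induction n) auto

lemma prod_X_power: "(\<Prod>i<n. fps_X ^ (5 * i + 1)) = (fps_X ^ (5 * tri n + n) :: rat fps)"
  by (induction n) (simp_all add: algebra_simps flip: power_add power_Suc)

text \<open>The factors are \<open>fps_X ^ (5 * n) - fps_X ^ (5 * i + 1)\<close>. For
  \<open>i < n\<close> the second monomial is taken out, and reversing the order leaves exponents 4
  modulo 5; for \<open>i >= n\<close> the first is taken out, leaving exponents 1 modulo 5.\<close>

lemma prod_shifted_factors:
  "(\<Prod>i<2 * n. fps_X ^ (5 * n) + (- fps_X) * (fps_X ^ 5) ^ i)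
   = (- 1) ^ n * fps_X ^ (5 * tri n + n + 5 * (n * n)) *
     ((\<Prod>i<n. 1 - fps_X ^ (5 * i + 1)) * (\<Prod>i<n. 1 - fps_X ^ (5 * i + 4)) :: rat fps)"
proof -
  define f where "f i = (fps_X ^ (5 * n) - fps_X ^ (5 * i + 1) :: rat fps)" for i
  have f: "fps_X ^ (5 * n) + (- fps_X) * (fps_X ^ 5) ^ i = f i" for i
    by (simp add: f_def flip: power_mult)
  have "f (n - Suc i) = - (fps_X ^ (5 * (n - Suc i) + 1)) * (1 - fps_X ^ (5 * i + 4))" if "i < n" for i
  proof -
    have "5 * n = (5 * (n - Suc i) + 1) + (5 * i + 4)"
      using that by linarith
    then have "(fps_X ^ (5 * n) :: rat fps) = fps_X ^ (5 * (n - Suc i) + 1) * fps_X ^ (5 * i + 4)"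
      by (metis power_add)
    moreover have "b * d - b = - b * (1 - d)" for b d :: "rat fps"
      by (simp add: algebra_simps)
    ultimately show ?thesis
      by (simp only: f_def)
  qed
  then have "(\<Prod>i<n. f (n - Suc i))
    = (\<Prod>i<n. - (fps_X ^ (5 * (n - Suc i) + 1)) * (1 - fps_X ^ (5 * i + 4)))"
    by (intro prod.cong) auto
  also have "\<dots> = (\<Prod>i<n. - (fps_X ^ (5 * (n - Suc i) + 1))) * (\<Prod>i<n. 1 - fps_X ^ (5 * i + 4))"
    by (rule prod.distrib)
  also have "(\<Prod>i<n. - (fps_X ^ (5 * (n - Suc i) + 1))) = (\<Prod>i<n. - (fps_X ^ (5 * i + 1)) :: rat fps)"
    by (rule prod.nat_diff_reindex)
  also have "\<dots> = (- 1) ^ n * fps_X ^ (5 * tri n + n)"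
    by (simp only: prod_uminus prod_X_power) simp
  finally have lo: "(\<Prod>i<n. f i) = (- 1) ^ n * fps_X ^ (5 * tri n + n) * (\<Prod>i<n. 1 - fps_X ^ (5 * i + 4))"
    by (simp only: prod.nat_diff_reindex)
  have "f (i + n) = fps_X ^ (5 * n) * (1 - fps_X ^ (5 * i + 1))" for i
    by (simp add: f_def algebra_simps power_add)
  then have hi: "(\<Prod>i<n. f (i + n)) = fps_X ^ (5 * (n * n)) * (\<Prod>i<n. 1 - fps_X ^ (5 * i + 1))"
    by (simp only: prod.distrib prod_constant card_lessThan power_mult[symmetric] mult.assoc)
  have "(\<Prod>i<2 * n. f i) = (\<Prod>i<n. f i) * (\<Prod>i=n..<2 * n. f i)"
    by (subst prod.union_disjoint[symmetric]) (auto intro!: prod.cong)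
  also have "(\<Prod>i=n..<2 * n. f i) = (\<Prod>i<n. f (i + n))"
    using prod.shift_bounds_nat_ivl[of f 0 n n] by (simp add: lessThan_atLeast0 mult_2)
  finally show ?thesis
    unfolding f lo hi power_add by (simp only: mult_ac)
qed

text \<open>The q-binomial theorem for \<open>a = Q ^ n\<close> and \<open>b = - q\<close>: both sides contain the monomial
  \<open>c\<close> below, and the indices \<open>n - r\<close> and \<open>n + r + 1\<close> give the two sums.\<close>

lemma finite_triple_product:
  fixes Q :: "rat fps"
  defines "Q \<equiv> fps_X ^ 5"
  shows "(\<Prod>i<n. 1 - fps_X ^ (5 * i + 1)) * (\<Prod>i<n. 1 - fps_X ^ (5 * i + 4))
    = (\<Sum>r\<le>n. (- 1) ^ r * fps_X ^ (rr_exp r + 2 * r) * qbin Q (2 * n) (n - r))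
    - (\<Sum>r<n. (- 1) ^ r * fps_X ^ (rr_exp r + 4 * r + 1) * qbin Q (2 * n) (n + Suc r))"
    (is "?Z = ?S1 - ?S2")
proof -
  define c :: "rat fps" where "c = (- 1) ^ n * fps_X ^ (5 * tri n + n + 5 * (n * n))"
  define g where "g j = qbin Q (2 * n) j * Q ^ tri j * (fps_X ^ (5 * n)) ^ (2 * n - j) * (- fps_X) ^ j" for j
  have g: "g j = (- 1) ^ j * fps_X ^ (5 * tri j + 5 * n * (2 * n - j) + j) * qbin Q (2 * n) j" for j
    by (simp add: g_def Q_def power_add power_minus[of fps_X] mult_ac flip: power_mult)
  have lo: "g (n - r) = c * ((- 1) ^ r * fps_X ^ (rr_exp r + 2 * r) * qbin Q (2 * n) (n - r))"
    if r: "r \<le> n" for r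
  proof -
    \<comment> \<open>This substitution removes the subtractions from the exponents, which then
      agree by \<open>double_tri\<close>.\<close>
    obtain t where t: "n = t + r"
      by (rule that[of "n - r"]) (use r in simp)
    have "5 * tri t + 5 * (t + r) * (2 * (t + r) - t) + t
        = 5 * tri (t + r) + (t + r) + 5 * ((t + r) * (t + r)) + (rr_exp r + 2 * r)"
      using double_tri[of r] by (simp add: tri_add rr_exp_tri algebra_simps)
    then have e: "fps_X ^ (5 * tri (n - r) + 5 * n * (2 * n - (n - r)) + (n - r))
      = (fps_X ^ (5 * tri n + n + 5 * (n * n)) * fps_X ^ (rr_exp r + 2 * r) :: rat fps)"
      by (simp add: t flip: power_add)
    have s: "(- 1) ^ (n - r) = ((- 1) ^ n * (- 1) ^ r :: rat fps)"
      by (simp add: t power_add flip: power_mult_distrib)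
    show ?thesis unfolding g c_def e s by (simp only: mult_ac)
  qed
  have hi: "g (n + Suc r) = - c * ((- 1) ^ r * fps_X ^ (rr_exp r + 4 * r + 1) * qbin Q (2 * n) (n + Suc r))"
    if r: "r < n" for r
  proof -
    obtain t where t: "n = t + Suc r"
      by (rule that[of "n - Suc r"]) (use r in simp)
    have "5 * tri (n + Suc r) + 5 * n * (2 * n - (n + Suc r)) + (n + Suc r)
        = (5 * tri n + n + 5 * (n * n)) + (rr_exp r + 4 * r + 1)"
      unfolding tri_add by (simp add: rr_exp_tri t algebra_simps)
    then have e: "fps_X ^ (5 * tri (n + Suc r) + 5 * n * (2 * n - (n + Suc r)) + (n + Suc r))
      = (fps_X ^ (5 * tri n + n + 5 * (n * n)) * fps_X ^ (rr_exp r + 4 * r + 1) :: rat fps)"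
      by (simp only: power_add)
    have s: "(- 1) ^ (n + Suc r) = (- ((- 1) ^ n * (- 1) ^ r) :: rat fps)"
      by (simp add: power_add)
    show ?thesis unfolding g c_def e s by (simp only: mult_ac mult_minus_left mult_minus_right)
  qed
  have "c * ?Z = (\<Prod>i<2 * n. fps_X ^ (5 * n) + (- fps_X) * Q ^ i)"
    unfolding c_def Q_def prod_shifted_factors ..
  also have "\<dots> = (\<Sum>j\<le>2 * n. g j)"
    unfolding g_def by (rule q_binomial)
  also have "\<dots> = (\<Sum>j\<le>n. g j) + (\<Sum>j=n + 1..n + n. g j)"
    by (subst sum.union_disjoint[symmetric]) (auto intro!: sum.cong)
  also have "(\<Sum>j\<le>n. g j) = (\<Sum>r\<le>n. g (n - r))"
    by (rule sum.reindex_bij_witness[of _ "\<lambda>r. n - r" "\<lambda>j. n - j"]) auto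
  also have "\<dots> = c * ?S1"
    unfolding sum_distrib_left by (intro sum.cong refl lo) simp
  also have "(\<Sum>j=n + 1..n + n. g j) = (\<Sum>r<n. g (n + Suc r))"
    by (rule sum.reindex_bij_witness[of _ "\<lambda>r. n + Suc r" "\<lambda>j. j - Suc n"]) auto
  also have "\<dots> = - c * ?S2"
    unfolding sum_distrib_left by (intro sum.cong refl hi) simp
  finally have "c * ?Z = c * (?S1 - ?S2)"
    by (simp add: right_diff_distrib)
  moreover have "c \<noteq> 0" by (simp add: c_def)
  ultimately show ?thesis by simp
qed

text \<open>Finite form of the limit 1/(Q)_oo of the central q-binomials. The left side is (Q)_n
  (Q)_(2n) / ((Q)_(n-t) (Q)_(n+t)), where (Q)_n agrees with (Q)_(n-t), and (Q)_(2n) with (Q)_(n+t),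
  below order \<open>n - t + 1\<close> in \<open>Q\<close>.\<close>

lemma fcong_qbin_central:
  fixes Q :: "rat fps"
  defines "Q \<equiv> fps_X ^ 5"
  assumes "t \<le> n" "k = n - t \<or> k = n + t"
  shows "fcong (5 * (n - t + 1)) (qfact Q n * qbin Q (2 * n) k) 1"
proof -
  let ?u = "qfact Q (n - t) * qfact Q (n + t)"
  have "qbin Q (2 * n) k * qfact Q k * qfact Q (2 * n - k) = qfact Q (2 * n)"
    by (rule qbin_qfact) (use assms in auto)
  moreover have "2 * n - (n - t) = n + t" "2 * n - (n + t) = n - t"
    using assms(2) by auto
  ultimately have "qbin Q (2 * n) k * ?u = qfact Q (2 * n)"
    using assms(3) by (auto simp: mult_ac)
  then have e: "?u * (qfact Q n * qbin Q (2 * n) k) = qfact Q n * qfact Q (2 * n)"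
    by (simp add: mult_ac)
  have "fcong (5 * (n - t + 1)) (qfact Q n) (qfact Q (n - t))"
    unfolding Q_def by (rule fcong_qfact) auto
  moreover have "fcong (5 * (n - t + 1)) (qfact Q (2 * n)) (qfact Q (n + t))"
    unfolding Q_def using assms(2) by (intro fcong_mono[OF fcong_qfact[of 5 "n + t"]]) auto
  ultimately have "fcong (5 * (n - t + 1)) (?u * (qfact Q n * qbin Q (2 * n) k)) (?u * 1)"
    unfolding e mult_1_right by (rule fcong_mult)
  then show ?thesis
    by (rule fcong_cancel) (simp add: Q_def qfact_X_power_nth_0)
qed

lemma rr_alt_sum_1_eq_prod:
  "fcong n (qfact (fps_X ^ 5) n *
      ((\<Prod>i<n. 1 - fps_X ^ (5 * i + 1)) * (\<Prod>i<n. 1 - fps_X ^ (5 * i + 4))))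
    (rr_alt_sum n 1)"
proof -
  define Q :: "rat fps" where "Q = fps_X ^ 5"
  \<comment> \<open>The q-binomial is close to its limit only up to order
    \<open>5 * (n - t + 1)\<close>, which is poor for large \<open>t\<close>; there the monomial
    \<open>fps_X ^ e\<close> supplies the missing order.\<close>
  have *: "fcong n ((- 1) ^ r * fps_X ^ e * (qfact Q n * qbin Q (2 * n) k)) ((- 1) ^ r * fps_X ^ e)"
    if "t \<le> n" "k = n - t \<or> k = n + t" "n \<le> e + 5 * (n - t + 1)" for r e k t
  proof -
    have "fcong (e + 5 * (n - t + 1)) (fps_X ^ e * (qfact Q n * qbin Q (2 * n) k)) (fps_X ^ e * 1)"
      unfolding Q_def by (intro fcong_X_power_mult fcong_qbin_central that)
    from fcong_mult_left[OF fcong_mono[OF this that(3)], of "(- 1) ^ r"]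
    show ?thesis by (simp only: mult.assoc mult_1_right)
  qed
  have ge: "2 * r \<le> rr_exp r" for r by (rule rr_exp_ge)
  have "fcong n (\<Sum>r\<le>n. (- 1) ^ r * fps_X ^ (rr_exp r + 2 * r) * (qfact Q n * qbin Q (2 * n) (n - r)))
      (\<Sum>r\<le>n. (- 1) ^ r * fps_X ^ (rr_exp r + 2 * r))" (is "fcong n ?S1 _")
  proof (intro fcong_sum *)
    fix r assume "r \<in> {..n}"
    then show "n \<le> rr_exp r + 2 * r + 5 * (n - r + 1)"
      using ge[of r] by auto
  qed auto
  also have "(\<Sum>r\<le>n. (- 1) ^ r * fps_X ^ (rr_exp r + 2 * r) :: rat fps)
    = (\<Sum>r<n. (- 1) ^ r * fps_X ^ (rr_exp r + 2 * r)) + fps_X ^ (rr_exp n + 2 * n) * (- 1) ^ n"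
    by (simp add: lessThan_Suc_atMost[symmetric] mult_ac)
  \<comment> \<open>The term for \<open>r = n\<close> is dropped, its exponent being at least
    \<open>n\<close>.\<close>
  finally have 1: "fcong n ?S1 (\<Sum>r<n. (- 1) ^ r * fps_X ^ (rr_exp r + 2 * r))"
    by (rule fcong_trans) (use fcong_add[OF fcong_refl fcong_X_power_0] in force)
  have 2: "fcong n (\<Sum>r<n. (- 1) ^ r * fps_X ^ (rr_exp r + 4 * r + 1) * (qfact Q n * qbin Q (2 * n) (n + Suc r)))
      (\<Sum>r<n. (- 1) ^ r * fps_X ^ (rr_exp r + 4 * r + 1))" (is "fcong n ?S2 _")
  proof (rule fcong_sum)
    fix r assume "r \<in> {..<n}"
    then show "fcong n ((- 1) ^ r * fps_X ^ (rr_exp r + 4 * r + 1) * (qfact Q n * qbin Q (2 * n) (n + Suc r)))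
      ((- 1) ^ r * fps_X ^ (rr_exp r + 4 * r + 1))"
      using ge[of r] by (intro *[of "Suc r"]) auto
  qed
  have "?S1 - ?S2 = qfact Q n * ((\<Prod>i<n. 1 - fps_X ^ (5 * i + 1)) * (\<Prod>i<n. 1 - fps_X ^ (5 * i + 4)))"
    unfolding finite_triple_product Q_def[symmetric]
    by (simp only: right_diff_distrib sum_distrib_left mult_ac)
  \<comment> \<open>At \<open>k = 1\<close> the factor \<open>1 - fps_X ^ (1 + 2 * r)\<close> splits
    each \<open>rr_term\<close> into one monomial of either sum.\<close>
  moreover have "(\<Sum>r<n. (- 1) ^ r * fps_X ^ (rr_exp r + 2 * r)) - (\<Sum>r<n. (- 1) ^ r * fps_X ^ (rr_exp r + 4 * r + 1))
    = rr_alt_sum n 1"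
    unfolding rr_alt_sum_def sum_subtractf[symmetric]
  proof (intro sum.cong refl)
    fix r
    have "rr_exp r + 4 * r + 1 = (2 * 1 * r + rr_exp r) + (1 + 2 * r)" "rr_exp r + 2 * r = 2 * 1 * r + rr_exp r"
      by simp_all
    then have "fps_X ^ (rr_exp r + 4 * r + 1) = fps_X ^ (2 * 1 * r + rr_exp r) * (fps_X ^ (1 + 2 * r) :: rat fps)"
      "fps_X ^ (rr_exp r + 2 * r) = (fps_X ^ (2 * 1 * r + rr_exp r) :: rat fps)"
      by (simp_all only: power_add)
    then show "(- 1) ^ r * fps_X ^ (rr_exp r + 2 * r) - (- 1) ^ r * fps_X ^ (rr_exp r + 4 * r + 1) = rr_term 1 r"
      unfolding rr_term_def by (simp only: atLeastLessThan_empty order_refl prod.empty)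
        (simp only: right_diff_distrib mult_1_right mult.assoc)
  qed
  ultimately show ?thesis
    using fcong_diff[OF 1 2] by (simp add: Q_def)
qed

lemma fps_nth_prod_0: "fps_nth (prod f A) 0 = (\<Prod>i\<in>A. fps_nth (f i) 0)"
  by (induction A rule: infinite_finite_induct) auto

text \<open>The factors are sorted by their exponents modulo 5; residue 0 gives the q-factorial to
  base \<open>fps_X ^ 5\<close>.\<close>

lemma qfact_5_mult:
  "qfact fps_X (5 * n) = qfact (fps_X ^ 5) n *
     ((\<Prod>i<n. 1 - fps_X ^ (5 * i + 1)) * (\<Prod>i<n. 1 - fps_X ^ (5 * i + 4))) *
     ((\<Prod>i<n. 1 - fps_X ^ (5 * i + 2)) * (\<Prod>i<n. 1 - fps_X ^ (5 * i + 3)) :: rat fps)"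
proof (induction n)
  case (Suc n)
  have "5 * Suc n = Suc (Suc (Suc (Suc (Suc (5 * n)))))" by simp
  then have "qfact fps_X (5 * Suc n) = qfact (fps_X :: rat fps) (5 * n) * (1 - fps_X ^ (5 * n + 1)) *
    (1 - fps_X ^ (5 * n + 2)) * (1 - fps_X ^ (5 * n + 3)) * (1 - fps_X ^ (5 * n + 4)) * (1 - fps_X ^ (5 * Suc n))"
    by (simp only: qfact_Suc) (simp add: numeral_eq_Suc)
  then show ?case
    unfolding Suc.IH prod.lessThan_Suc qfact_Suc power_mult[symmetric] by (simp only: mult_ac)
qed simp

text \<open>With \<open>k = 1\<close> and \<open>L = 5 * n\<close>, the residues 0, 1, 4 in (q)_(5n)
  form exactly the product supplied by the triple product. It is a unit and cancels, leaving the
  residues 2 and 3.\<close>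

theorem rogers_ramanujan_2:
  "fcong n (((\<Prod>i<n. 1 - fps_X ^ (5 * i + 2)) * (\<Prod>i<n. 1 - fps_X ^ (5 * i + 3))) * rr_sum n 1) 1"
proof -
  let ?u = "qfact (fps_X ^ 5) n *
     ((\<Prod>i<n. 1 - fps_X ^ (5 * i + 1)) * (\<Prod>i<n. 1 - fps_X ^ (5 * i + 4))) :: rat fps"
  have "fcong n (qfact fps_X (5 * n) * rr_sum n 1) (?u * 1)"
    using fcong_trans[OF fcong_sym[OF rr_alt_sum_eq_rr_sum] fcong_sym[OF rr_alt_sum_1_eq_prod], of n "5 * n"]
    by simp
  then have "fcong n (?u * (((\<Prod>i<n. 1 - fps_X ^ (5 * i + 2)) * (\<Prod>i<n. 1 - fps_X ^ (5 * i + 3))) * rr_sum n 1)) (?u * 1)"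
    unfolding qfact_5_mult by (simp only: mult.assoc)
  then show ?thesis
    by (rule fcong_cancel) (simp add: qfact_X_power_nth_0 fps_nth_prod_0)
qed

section \<open>Generating functions of sets of multisets\<close>

text \<open>Multisets replace sorted lists of parts, so that adding or removing a block of parts is
  plain addition or subtraction.\<close>

definition bags :: "nat set \<Rightarrow> nat multiset set" where
  "bags A = {M. set_mset M \<subseteq> A}"

text \<open>Meaningful only if no multiset in \<open>S\<close> contains 0: otherwise the sets below may be
  infinite, and \<open>card\<close> is then 0.\<close>

definition gf :: "nat multiset set \<Rightarrow> rat fps" where
  "gf S = Abs_fps (\<lambda>N. of_nat (card {M \<in> S. \<Sum>\<^sub># M = N}))"

lemma is_partition_rev_sorted_list_of_multiset:
  "0 \<notin># M \<Longrightarrow> is_partition (rev (sorted_list_of_multiset M))"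
  by (auto simp: is_partition_def sorted_wrt_rev intro: gr0I)
 
lemma is_partition_mset_inj:
  assumes "is_partition xs" "is_partition ys" "mset xs = mset ys"
  shows "xs = ys"
proof -
  have "sorted (rev xs)" "sorted (rev ys)"
    using assms by (simp_all add: is_partition_def sorted_wrt_rev)
  moreover have "mset (rev xs) = mset (rev ys)"
    using assms by simp
  ultimately have "rev xs = rev ys"
    using properties_for_sort by metis
  then show ?thesis by simp
qed

text \<open>A partition is determined by its multiset of parts and recovered as the reversed sorted
  list.\<close>

lemma card_partitions_eq_card_bags:
  assumes "0 \<notin> A"
  shows "card {xs \<in> partitions_of N. set xs \<subseteq> A} = card {M \<in> bags A. \<Sum>\<^sub># M = N}"
proof (rule bij_betw_same_card)
  show "bij_betw mset {xs \<in> partitions_of N. set xs \<subseteq> A} {M \<in> bags A. \<Sum>\<^sub># M = N}"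
    unfolding bij_betw_def
  proof
    show "inj_on mset {xs \<in> partitions_of N. set xs \<subseteq> A}"
      by (auto simp: inj_on_def partitions_of_def intro: is_partition_mset_inj)
    show "mset ` {xs \<in> partitions_of N. set xs \<subseteq> A} = {M \<in> bags A. \<Sum>\<^sub># M = N}"
    proof (intro equalityI subsetI)
      fix M assume M: "M \<in> {M \<in> bags A. \<Sum>\<^sub># M = N}"
      let ?xs = "rev (sorted_list_of_multiset M)"
      have "0 \<notin># M" using M assms by (auto simp: bags_def)
      moreover have "mset ?xs = M" by simp
      moreover from this have "sum_list ?xs = N" using M by (metis (mono_tags, lifting) mem_Collect_eq sum_mset_sum_list)
      ultimately have "?xs \<in> {xs \<in> partitions_of N. set xs \<subseteq> A}"
        using M by (auto simp: partitions_of_def bags_def intro: is_partition_rev_sorted_list_of_multiset)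
      then show "M \<in> mset ` {xs \<in> partitions_of N. set xs \<subseteq> A}"
        using \<open>mset ?xs = M\<close> by (metis imageI)
    qed (auto simp: partitions_of_def bags_def sum_mset_sum_list)
  qed
qed

lemma finite_bags_of_sum:
  assumes "S \<subseteq> bags {0<..}"
  shows "finite {M \<in> S. \<Sum>\<^sub># M = N}"
proof (rule finite_subset)
  show "finite (mset ` partitions_of N)"
    by (simp add: finite_partitions_of)
  show "{M \<in> S. \<Sum>\<^sub># M = N} \<subseteq> mset ` partitions_of N"
  proof
    fix M assume "M \<in> {M \<in> S. \<Sum>\<^sub># M = N}"
    then have M: "0 \<notin># M" "\<Sum>\<^sub># M = N"
      using assms by (auto simp: bags_def)
    have "sum_list (rev (sorted_list_of_multiset M)) = \<Sum>\<^sub># (mset (rev (sorted_list_of_multiset M)))"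
      by (rule sum_mset_sum_list[symmetric])
    then have "rev (sorted_list_of_multiset M) \<in> partitions_of N"
      using M is_partition_rev_sorted_list_of_multiset[OF M(1)] by (simp add: partitions_of_def)
    moreover have "M = mset (rev (sorted_list_of_multiset M))" by simp
    ultimately show "M \<in> mset ` partitions_of N" by blast
  qed
qed

lemma gf_Un:
  assumes "S \<union> T \<subseteq> bags {0<..}" "S \<inter> T = {}"
  shows "gf (S \<union> T) = gf S + gf T"
proof (rule fps_ext)
  fix N
  have "{M \<in> S \<union> T. \<Sum>\<^sub># M = N} = {M \<in> S. \<Sum>\<^sub># M = N} \<union> {M \<in> T. \<Sum>\<^sub># M = N}"
    by auto
  moreover have "card \<dots> = card {M \<in> S. \<Sum>\<^sub># M = N} + card {M \<in> T. \<Sum>\<^sub># M = N}"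
    using assms by (intro card_Un_disjoint finite_bags_of_sum) auto
  ultimately show "fps_nth (gf (S \<union> T)) N = fps_nth (gf S + gf T) N"
    by (simp add: gf_def)
qed

lemma gf_shift: "gf ((+) M0 ` S) = fps_X ^ \<Sum>\<^sub># M0 * gf S"
proof (rule fps_ext)
  fix N
  let ?T = "{M \<in> (+) M0 ` S. \<Sum>\<^sub># M = N}"
  have "card ?T = (if N < \<Sum>\<^sub># M0 then 0 else card {M \<in> S. \<Sum>\<^sub># M = N - \<Sum>\<^sub># M0})"
  proof (cases "N < \<Sum>\<^sub># M0")
    case True
    then have "?T = {}" by auto
    with True show ?thesis by (metis card.empty)
  next
    case False
    then have "?T = (+) M0 ` {M \<in> S. \<Sum>\<^sub># M = N - \<Sum>\<^sub># M0}"
      by auto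
    with False show ?thesis by (simp add: card_image)
  qed
  then show "fps_nth (gf ((+) M0 ` S)) N = fps_nth (fps_X ^ \<Sum>\<^sub># M0 * gf S) N"
    by (simp add: gf_def fps_X_power_mult_nth)
qed

text \<open>A geometric series in disguise: \<open>T\<close> collects the multisets of
  \<open>S\<close> from which no block \<open>M0\<close> can be removed within
  \<open>S\<close>.\<close>

lemma gf_recurrence:
  assumes "S = T \<union> (+) M0 ` S" "S \<subseteq> bags {0<..}" "T \<inter> (+) M0 ` S = {}"
  shows "(1 - fps_X ^ \<Sum>\<^sub># M0) * gf S = gf T"
proof -
  have "gf S = gf T + fps_X ^ \<Sum>\<^sub># M0 * gf S"
    using gf_Un[of T "(+) M0 ` S"] assms gf_shift[of M0 S] by metis
  then show ?thesis by (simp add: algebra_simps)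
qed

lemma in_image_plus_iff: "M \<in> (+) M0 ` S \<longleftrightarrow> M0 \<subseteq># M \<and> M - M0 \<in> S"
  by (auto intro: image_eqI[of _ _ "M - M0"])

lemma bags_diff_iff:
  assumes "set_mset M0 \<subseteq> A"
  shows "M - M0 \<in> bags A \<longleftrightarrow> M \<in> bags A"
proof -
  have "x \<in># M - M0" if "x \<in># M" "x \<notin># M0" for x
    using that by (simp add: in_diff_count not_in_iff)
  then show ?thesis
    using assms by (auto simp: bags_def dest: in_diffD)
qed

lemma bags_remove_iff: "M \<in> bags (A - {a}) \<longleftrightarrow> M \<in> bags A \<and> a \<notin># M"
  by (auto simp: bags_def)

lemma gf_bags_insert:
  assumes "0 < a" "a \<notin> A" "A \<subseteq> {0<..}"
  shows "(1 - fps_X ^ a) * gf (bags (insert a A)) = gf (bags A)"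
proof -
  have "(1 - fps_X ^ \<Sum>\<^sub># {#a#}) * gf (bags (insert a A)) = gf (bags A)"
  proof (rule gf_recurrence)
    show "bags (insert a A) = bags A \<union> (+) {#a#} ` bags (insert a A)"
      unfolding set_eq_iff Un_iff in_image_plus_iff
      by (auto simp: bags_diff_iff) (auto simp: bags_def)
    show "bags (insert a A) \<subseteq> bags {0<..}"
      using assms by (auto simp: bags_def)
    show "bags A \<inter> (+) {#a#} ` bags (insert a A) = {}"
      using assms by (auto simp: bags_def)
  qed
  then show ?thesis by simp
qed

lemma gf_bags_empty: "gf (bags {}) = 1"
proof (rule fps_ext)
  fix N
  have "{M \<in> bags {}. \<Sum>\<^sub># M = N} = (if N = 0 then {{#}} else {})"
    by (auto simp: bags_def)
  then show "fps_nth (gf (bags {})) N = fps_nth 1 N"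
    by (simp add: gf_def)
qed

lemma gf_bags:
  assumes "finite A" "A \<subseteq> {0<..}"
  shows "(\<Prod>a\<in>A. 1 - fps_X ^ a) * gf (bags A) = 1"
  using assms
proof (induction A rule: finite_induct)
  case (insert a A)
  then have "(\<Prod>a\<in>insert a A. 1 - fps_X ^ a) * gf (bags (insert a A))
    = (\<Prod>a\<in>A. 1 - fps_X ^ a) * ((1 - fps_X ^ a) * gf (bags (insert a A)))"
    by (simp add: mult_ac)
  with insert show ?case by (simp add: gf_bags_insert)
qed (simp add: gf_bags_empty)

text \<open>Removing pairs \<open>{#a, b#}\<close> ends at a multiset without \<open>b\<close>. Thus
  the generating function has a factor for a part \<open>a + b\<close> in place of the one for
  \<open>b\<close>.\<close>

lemma gf_bags_count_ge:
  assumes "a \<in> A" "b \<in> A" "a \<noteq> b" "A \<subseteq> {0<..}"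
  shows "(1 - fps_X ^ (a + b)) * gf {M \<in> bags A. count M b \<le> count M a} = (1 - fps_X ^ b) * gf (bags A)"
proof -
  let ?S = "{M \<in> bags A. count M b \<le> count M a}"
  have "(1 - fps_X ^ \<Sum>\<^sub># {#a, b#}) * gf ?S = gf (bags (A - {b}))"
  proof (rule gf_recurrence)
    have "M \<in> ?S \<longleftrightarrow> M \<in> bags (A - {b}) \<or> {#a, b#} \<subseteq># M \<and> M - {#a, b#} \<in> ?S" for M
    proof -
      have "M - {#a, b#} \<in> bags A \<longleftrightarrow> M \<in> bags A"
        using assms by (intro bags_diff_iff) auto
      moreover have "{#a, b#} \<subseteq># M \<longleftrightarrow> 0 < count M a \<and> 0 < count M b"
        using assms(3) by (auto simp: insert_subset_eq_iff in_diff_count simp flip: count_greater_zero_iff)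
      ultimately show ?thesis
        using assms(3) by (cases "count M a"; cases "count M b") (auto simp: bags_remove_iff not_in_iff)
    qed
    then show "?S = bags (A - {b}) \<union> (+) {#a, b#} ` ?S"
      unfolding set_eq_iff Un_iff in_image_plus_iff by blast
    show "?S \<subseteq> bags {0<..}"
      using assms by (auto simp: bags_def)
    show "bags (A - {b}) \<inter> (+) {#a, b#} ` ?S = {}"
      using assms by (auto simp: bags_def)
  qed
  moreover have "(1 - fps_X ^ b) * gf (bags (insert b (A - {b}))) = gf (bags (A - {b}))"
    using assms by (intro gf_bags_insert) auto
  ultimately show ?thesis
    using assms(2) by (simp add: insert_absorb)
qed

text \<open>Removing \<open>s\<close> copies of \<open>a\<close> keeps the residue, so the base
  consists of the multisets whose count of \<open>a\<close> itself lies in \<open>R\<close>.\<close>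

lemma gf_bags_count_mod:
  assumes "a \<in> A" "A \<subseteq> {0<..}" "R \<subseteq> {..<s}" 
  shows "(1 - fps_X ^ (s * a)) * gf {M \<in> bags A. count M a mod s \<in> R}
       = (\<Sum>r\<in>R. fps_X ^ (r * a)) * gf (bags (A - {a}))"
proof -
  let ?S = "{M \<in> bags A. count M a mod s \<in> R}"
  let ?T = "\<lambda>R. {M \<in> bags A. count M a \<in> R}"
  have fin: "finite R" using assms(3) finite_subset by blast
  have T: "gf (?T R) = (\<Sum>r\<in>R. fps_X ^ (r * a)) * gf (bags (A - {a}))" if "finite R" for R
    using that
  proof (induction R rule: finite_induct)
    case empty
    show ?case by (simp add: gf_def fps_eq_iff)
  next
    case (insert r R)
    \<comment> \<open>A multiset with exactly \<open>r\<close> copies of \<open>a\<close> is a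
      multiset avoiding \<open>a\<close> plus that block.\<close>
    have "?T {r} = (+) (replicate_mset r a) ` bags (A - {a})"
    proof (intro equalityI subsetI)
      fix M assume M: "M \<in> ?T {r}"
      then have "replicate_mset r a \<subseteq># M"
        by (auto simp: count_le_replicate_mset_subset_eq[symmetric])
      moreover have "M - replicate_mset r a \<in> bags (A - {a})"
        using M by (auto simp: bags_def in_diff_count split: if_splits dest: in_diffD)
      ultimately show "M \<in> (+) (replicate_mset r a) ` bags (A - {a})"
        by (simp add: in_image_plus_iff)
    qed (use assms(1) in \<open>auto simp: bags_def not_in_iff split: if_splits\<close>)
    then have "gf (?T {r}) = fps_X ^ (r * a) * gf (bags (A - {a}))"
      by (simp add: gf_shift)
    moreover have "gf (?T {r} \<union> ?T R) = gf (?T {r}) + gf (?T R)"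
      by (rule gf_Un) (use insert assms in \<open>auto simp: bags_def\<close>)
    moreover have "?T (insert r R) = ?T {r} \<union> ?T R" by auto
    ultimately show ?case using insert by (simp add: distrib_right)
  qed
  have "(1 - fps_X ^ \<Sum>\<^sub># (replicate_mset s a)) * gf ?S = gf (?T R)"
  proof (rule gf_recurrence)
    have "M \<in> ?S \<longleftrightarrow> M \<in> ?T R \<or> replicate_mset s a \<subseteq># M \<and> M - replicate_mset s a \<in> ?S" for M
    proof (cases "s \<le> count M a")
      case True
      have "M \<in> bags A \<longleftrightarrow> M - replicate_mset s a \<in> bags A"
        using assms(1) by (intro bags_diff_iff[symmetric]) (auto split: if_splits)
      with True show ?thesis using assms(3)
        by (auto simp: le_mod_geq count_le_replicate_mset_subset_eq[symmetric])
    next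
      case False
      then show ?thesis by (auto simp: count_le_replicate_mset_subset_eq[symmetric])
    qed
    then show "?S = ?T R \<union> (+) (replicate_mset s a) ` ?S"
      unfolding set_eq_iff Un_iff in_image_plus_iff by blast
    show "?S \<subseteq> bags {0<..}"
      using assms by (auto simp: bags_def)
    show "?T R \<inter> (+) (replicate_mset s a) ` ?S = {}"
      using assms(3) by (auto simp: bags_def)
  qed
  then show ?thesis using T[OF fin] by simp
qed

section \<open>Columns\<close>

text \<open>A finite down-closed set of natural numbers is an initial segment, ending just before
  its cardinality.\<close>

lemma less_card_iff_down_closed:
  fixes D :: "nat set"
  assumes "finite D" "\<And>i j. i \<in> D \<Longrightarrow> j \<le> i \<Longrightarrow> j \<in> D"
  shows "i < card D \<longleftrightarrow> i \<in> D"
proof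
  assume "i \<in> D"
  then have "{..i} \<subseteq> D" using assms(2) by auto
  from card_mono[OF assms(1) this] show "i < card D" by simp
next
  assume i: "i < card D"
  show "i \<in> D"
  proof (rule ccontr)
    assume "i \<notin> D"
    then have "D \<subseteq> {..<i}" using assms(2) by (meson lessThan_iff linorder_not_le subsetI)
    from card_mono[OF _ this] i show False by simp
  qed
qed

text \<open>In a weakly decreasing list the positions of entries at least \<open>j\<close> form an
  initial segment, so its length is decided by positions \<open>k\<close> and
  \<open>Suc k\<close>.\<close>

lemma length_filter_ge_eq_iff:
  fixes ys :: "nat list"
  assumes "sorted_wrt (\<ge>) ys" "0 < j"
  shows "length (filter (\<lambda>p. j \<le> p) ys) = Suc k \<longleftrightarrow>
    k < length ys \<and> j \<le> ys ! k \<and> (Suc k < length ys \<longrightarrow> ys ! Suc k < j)"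
proof -
  define D where "D = {i. i < length ys \<and> j \<le> ys ! i}"
  have fin: "finite D" unfolding D_def by simp
  have closed: "i' \<in> D" if "i \<in> D" "i' \<le> i" for i i'
  proof (cases "i' = i")
    case False
    then have "ys ! i \<le> ys ! i'"
      using that assms(1) by (auto simp: sorted_wrt_iff_nth_less D_def)
    then show ?thesis using that by (auto simp: D_def intro: le_trans)
  qed (use that in simp)
  have less: "i < card D \<longleftrightarrow> i \<in> D" for i
    using less_card_iff_down_closed[of D, OF fin] closed by blast
  have "length (filter (\<lambda>p. j \<le> p) ys) = card D"
    by (simp add: length_filter_conv_card D_def)
  moreover have "card D = Suc k \<longleftrightarrow> k < card D \<and> \<not> Suc k < card D"
    by auto
  ultimately show ?thesis
    unfolding less by (auto simp: D_def)
qed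

lemma count_list_map_filter: "count_list (map f xs) y = length (filter (\<lambda>x. f x = y) xs)"
  by (induction xs) auto

lemma le_foldr_max: "x \<in> set xs \<Longrightarrow> x \<le> foldr max xs (0::nat)"
  by (induction xs) auto

text \<open>The columns of height \<open>Suc k\<close> are those reaching row \<open>k\<close> but
  not the next row; past the last row the length is taken to be 0.\<close>

lemma count_list_conjugate:
  assumes "sorted_wrt (\<ge>) ys" "k < length ys"
  shows "count_list (conjugate ys) (Suc k) = ys ! k - (if Suc k < length ys then ys ! Suc k else 0)"
proof -
  define b where "b = (if Suc k < length ys then ys ! Suc k else 0)"
  let ?n = "foldr max ys 0"
  have le: "ys ! k \<le> ?n" using assms(2) by (intro le_foldr_max) simp
  have "count_list (conjugate ys) (Suc k)
      = length (filter (\<lambda>j. length (filter (\<lambda>p. j \<le> p) ys) = Suc k) [1..<Suc ?n])"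
    by (simp add: conjugate_def count_list_map_filter del: upt_Suc)
  also have "\<dots> = card {j \<in> {1..<Suc ?n}. length (filter (\<lambda>p. j \<le> p) ys) = Suc k}"
    by (subst distinct_card[symmetric]) (auto simp: set_filter simp del: upt_Suc intro!: arg_cong[of _ _ card])
  also have "{j \<in> {1..<Suc ?n}. length (filter (\<lambda>p. j \<le> p) ys) = Suc k} = {b<..ys ! k}"
  proof -
    have "length (filter (\<lambda>p. j \<le> p) ys) = Suc k \<longleftrightarrow> j \<le> ys ! k \<and> b < j" if "0 < j" for j
      using length_filter_ge_eq_iff[OF assms(1) that, of k] assms(2) that by (auto simp: b_def)
    then show ?thesis using le by auto
  qed
  finally show ?thesis by (simp add: b_def)
qed

lemma set_conjugate: "set (conjugate ys) \<subseteq> {1..length ys}"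
proof
  fix x assume "x \<in> set (conjugate ys)"
  then obtain j where j: "1 \<le> j" "j \<le> foldr max ys 0" "x = length (filter (\<lambda>p. j \<le> p) ys)"
    by (auto simp: conjugate_def simp del: upt_Suc)
  have "\<exists>p\<in>set ys. j \<le> p" if "1 \<le> j" "j \<le> foldr max ys 0" for j
    using that by (induction ys) (auto simp: max_def split: if_splits)
  then have "filter (\<lambda>p. j \<le> p) ys \<noteq> []"
    using j by (auto simp: filter_empty_conv)
  then have "1 \<le> x" using j(3) by (simp add: Suc_le_eq)
  then show "x \<in> {1..length ys}" using j(3) by simp
qed

definition reduced :: "nat list \<Rightarrow> nat list" where
  "reduced xs = map (\<lambda>i. xs ! i - 2 * (length xs - i)) [0..<length xs]"

lemma col_star_eq: "col_star xs = conjugate (reduced xs)"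
  by (simp add: col_star_def reduced_def)

lemma length_reduced [simp]: "length (reduced xs) = length xs"
  by (simp add: reduced_def)

lemma nth_reduced: "i < length xs \<Longrightarrow> reduced xs ! i = xs ! i - 2 * (length xs - i)"
  by (simp add: reduced_def)

text \<open>The subtracted staircase falls by 2 per row, which the gaps of at least 2
  absorb.\<close>

lemma sorted_reduced:
  assumes "xs \<in> Diff2_star"
  shows "sorted_wrt (\<ge>) (reduced xs)"
proof -
  have "reduced xs ! Suc i \<le> reduced xs ! i" if "Suc i < length xs" for i
  proof -
    have "xs ! Suc i + 2 \<le> xs ! i"
      using assms that by (auto simp: Diff2_star_def Diff2_def)
    then show ?thesis using that by (simp add: nth_reduced)
  qed
  then show ?thesis
    by (subst sorted_wrt_iff_nth_Suc_transp) (auto intro: transpI)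
qed

text \<open>Length of row \<open>i\<close>, counted from 0, in the diagram with column heights
  \<open>M\<close>: the number of columns of height above \<open>i\<close> and at most
  \<open>m\<close>.\<close>

definition tail_count :: "nat \<Rightarrow> nat multiset \<Rightarrow> nat \<Rightarrow> nat" where
  "tail_count m M i = (\<Sum>k=Suc i..m. count M k)"

lemma tail_count_rec: "i < m \<Longrightarrow> tail_count m M i = count M (Suc i) + tail_count m M (Suc i)"
  by (simp add: tail_count_def sum.atLeast_Suc_atMost)

lemma tail_count_0: "m \<le> i \<Longrightarrow> tail_count m M i = 0"
  by (simp add: tail_count_def)

text \<open>Column counts are differences of consecutive rows, so summing them from the bottom row
  upwards recovers the rows.\<close>

lemma reduced_eq_tail_count:
  assumes "xs \<in> Diff2_star" "length xs = m" "i < m"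
  shows "reduced xs ! i = tail_count m (mset (col_star xs)) i"
  using assms(3)
proof (induction "m - i" arbitrary: i rule: less_induct)
  case less
  have c: "count (mset (col_star xs)) (Suc i)
      = reduced xs ! i - (if Suc i < m then reduced xs ! Suc i else 0)"
    using less.prems count_list_conjugate[OF sorted_reduced[OF assms(1)], of i] assms(2)
    by (simp add: col_star_eq count_mset)
  show ?case
  proof (cases "Suc i < m")
    case True
    then have "reduced xs ! Suc i = tail_count m (mset (col_star xs)) (Suc i)"
      using less by simp
    moreover have "reduced xs ! Suc i \<le> reduced xs ! i"
      using sorted_reduced[OF assms(1)] True assms(2) by (auto simp: sorted_wrt_iff_nth_less)
    ultimately show ?thesis
      using True c by (simp add: tail_count_rec)
  next
    case False
    then show ?thesis
      using c less.prems by (simp add: tail_count_rec tail_count_0)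
  qed
qed

text \<open>Inverse of \<open>col_star\<close> on partitions with \<open>m\<close> parts: rows are
  rebuilt from the columns and the staircase is put back. The columns do not show rows of length
  zero, hence the argument \<open>m\<close>.\<close>

definition of_columns :: "nat \<Rightarrow> nat multiset \<Rightarrow> nat list" where
  "of_columns m M = map (\<lambda>i. tail_count m M i + 2 * (m - i)) [0..<m]"

lemma length_of_columns [simp]: "length (of_columns m M) = m"
  by (simp add: of_columns_def)

lemma nth_of_columns: "i < m \<Longrightarrow> of_columns m M ! i = tail_count m M i + 2 * (m - i)"
  by (simp add: of_columns_def)

lemma of_columns_col_star:
  assumes "xs \<in> Diff2_star" "length xs = m"
  shows "of_columns m (mset (col_star xs)) = xs"
proof (rule nth_equalityI)
  fix i assume "i < length (of_columns m (mset (col_star xs)))"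
  then show "of_columns m (mset (col_star xs)) ! i = xs ! i"
    using reduced_eq_tail_count[OF assms] Diff2_star_nth_ge[OF assms(1)] assms(2)
    by (simp add: nth_of_columns nth_reduced flip: reduced_eq_tail_count[OF assms])
qed (use assms in simp)

text \<open>The staircase supplies the gaps and the lower bound 2 on the parts, and
  \<open>tail_count\<close> is weakly decreasing.\<close>

lemma of_columns_in_Diff2_star: "of_columns m M \<in> Diff2_star"
proof -
  have step: "of_columns m M ! Suc i + 2 \<le> of_columns m M ! i" if "Suc i < m" for i
    using that by (simp add: nth_of_columns tail_count_rec)
  have "sorted_wrt (\<ge>) (of_columns m M)"
    using step by (subst sorted_wrt_iff_nth_Suc_transp) (auto intro!: transpI intro: add_leD1 step)
  moreover have "2 \<le> p" if "p \<in> set (of_columns m M)" for p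
    using that by (auto simp: of_columns_def)
  then have "\<forall>p\<in>set (of_columns m M). 0 < p" "1 \<notin> set (of_columns m M)"
    by fastforce+
  ultimately show ?thesis
    using step by (auto simp: Diff2_star_def Diff2_def is_partition_def)
qed

lemma col_star_of_columns:
  assumes "M \<in> bags {1..m}"
  shows "mset (col_star (of_columns m M)) = M"
proof (rule multiset_eqI)
  fix k
  let ?xs = "of_columns m M"
  have red: "reduced ?xs ! i = tail_count m M i" if "i < m" for i
    using that by (simp add: nth_reduced nth_of_columns)
  show "count (mset (col_star ?xs)) k = count M k"
  proof (cases "k \<in> {1..m}")
    case True
    then obtain i where i: "k = Suc i" "i < m" by (cases k) auto
    have "count (mset (col_star ?xs)) k
        = reduced ?xs ! i - (if Suc i < m then reduced ?xs ! Suc i else 0)"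
      using i count_list_conjugate[OF sorted_reduced[OF of_columns_in_Diff2_star[of m M]], of i]
      by (simp add: col_star_eq count_mset)
    also have "\<dots> = count M k"
      using i by (auto simp: red tail_count_rec tail_count_0)
    finally show ?thesis .
  next
    case False
    then have "k \<notin># mset (col_star ?xs)"
      using set_conjugate[of "reduced ?xs"] by (auto simp: col_star_eq)
    moreover have "k \<notin># M" using False assms by (auto simp: bags_def)
    ultimately show ?thesis by (simp add: not_in_iff)
  qed
qed

lemma col_star_in_bags: "length xs = m \<Longrightarrow> mset (col_star xs) \<in> bags {1..m}"
  using set_conjugate[of "reduced xs"] by (simp add: bags_def col_star_eq)

lemma sum_mset_eq_sum_count:
  assumes "M \<in> bags {1..m}"
  shows "\<Sum>\<^sub># M = (\<Sum>k=1..m. k * count M k)"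
  using assms
proof (induction M)
  case (add x M)
  then have x: "x \<in> {1..m}" and M: "M \<in> bags {1..m}" by (auto simp: bags_def)
  have "(\<Sum>k=1..m. k * count (add_mset x M) k) = (\<Sum>k=1..m. k * count M k + (if k = x then x else 0))"
    by (intro sum.cong) auto
  also have "\<dots> = (\<Sum>k=1..m. k * count M k) + x"
    using x by (simp only: sum.distrib sum.delta finite_atLeastAtMost if_True)
  finally show ?case using add.IH[OF M] by simp
qed simp

lemma sum_tail_count: "(\<Sum>i<m. tail_count m M i) = (\<Sum>k=1..m. k * count M k)"
proof -
  \<comment> \<open>A column of height \<open>k\<close> meets \<open>k\<close> rows in all, but only
    \<open>n\<close> of the first \<open>n\<close> rows if it is higher than \<open>n\<close>; this
    gives the last summand.\<close>
  have "(\<Sum>i<n. tail_count m M i) = (\<Sum>k=1..n. k * count M k) + n * tail_count m M n" if "n \<le> m" for n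
    using that
  proof (induction n)
    case (Suc n)
    then show ?case by (simp add: tail_count_rec algebra_simps)
  qed simp
  from this[of m] show ?thesis by (simp add: tail_count_0)
qed

text \<open>The staircase contributes 2 + 4 + ... + 2m = m(m+1).\<close>

lemma sum_list_of_columns:
  assumes "M \<in> bags {1..m}"
  shows "sum_list (of_columns m M) = m * (m + 1) + \<Sum>\<^sub># M"
proof -
  have "sum_list (of_columns m M) = (\<Sum>i<m. tail_count m M i) + (\<Sum>i<m. 2 * (m - i))"
    by (simp add: of_columns_def interv_sum_list_conv_sum_set_nat sum.distrib lessThan_atLeast0)
  also have "(\<Sum>i<m. 2 * (m - i)) = m * (m + 1)"
    by (induction m) (simp_all only: sum.lessThan_Suc_shift, simp_all)
  finally show ?thesis
    using sum_mset_eq_sum_count[OF assms] sum_tail_count[of m M] by simp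
qed

lemma card_Diff2_star:
  "card {xs \<in> partitions_of N. xs \<in> Diff2_star \<and> length xs = m \<and> P (mset (col_star xs))}
   = card {M \<in> {M \<in> bags {1..m}. P M}. m * (m + 1) + \<Sum>\<^sub># M = N}" (is "card ?A = card ?B")
proof (rule bij_betw_same_card)
  have sum: "sum_list xs = m * (m + 1) + \<Sum>\<^sub># (mset (col_star xs))" if "xs \<in> Diff2_star" "length xs = m" for xs
    using sum_list_of_columns[OF col_star_in_bags[OF that(2)]] of_columns_col_star[OF that] by metis
  have part: "of_columns m M \<in> partitions_of N" if "M \<in> bags {1..m}" "m * (m + 1) + \<Sum>\<^sub># M = N" for M
    using of_columns_in_Diff2_star[of m M] sum_list_of_columns[OF that(1)] that(2)
    by (simp add: partitions_of_def Diff2_star_def Diff2_def)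
  show "bij_betw (\<lambda>xs. mset (col_star xs)) ?A ?B"
  proof (rule bij_betw_byWitness[of _ "of_columns m"])
    show "(\<lambda>xs. mset (col_star xs)) ` ?A \<subseteq> ?B"
      using sum by (auto simp: partitions_of_def simp flip: One_nat_def intro: col_star_in_bags)
    show "of_columns m ` ?B \<subseteq> ?A"
      using part by (auto simp: col_star_of_columns of_columns_in_Diff2_star)
  qed (auto simp: of_columns_col_star col_star_of_columns)
qed

lemma card_shifted_eq_nth_gf:
  "of_nat (card {M \<in> S. s + \<Sum>\<^sub># M = N}) = fps_nth (fps_X ^ s * gf S) N"
proof (cases "N < s")
  case False
  then have "{M \<in> S. s + \<Sum>\<^sub># M = N} = {M \<in> S. \<Sum>\<^sub># M = N - s}" by auto
  with False show ?thesis by (simp add: fps_X_power_mult_nth gf_def)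
next
  case True
  then have "{M \<in> S. s + \<Sum>\<^sub># M = N} = {}" by auto
  with True show ?thesis by (simp add: fps_X_power_mult_nth)
qed

section \<open>Comparing the generating functions\<close>

text \<open>Exactly \<open>n\<close> parts of each residue are taken, to match the finite products
  in \<open>rogers_ramanujan_2\<close>.\<close>

definition rr_parts :: "nat \<Rightarrow> nat set" where
  "rr_parts n = (\<lambda>i. 5 * i + 2) ` {..<n} \<union> (\<lambda>i. 5 * i + 3) ` {..<n}"

lemma in_rr_parts_iff:
  assumes "p < n"
  shows "p \<in> rr_parts n \<longleftrightarrow> p mod 5 = 2 \<or> p mod 5 = 3"
proof
  assume "p mod 5 = 2 \<or> p mod 5 = 3"
  then have "p = 5 * (p div 5) + 2 \<or> p = 5 * (p div 5) + 3" by presburger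
  moreover have "p div 5 < n" using assms by linarith
  ultimately show "p \<in> rr_parts n"
    unfolding rr_parts_def by blast
next
  assume "p \<in> rr_parts n"
  then obtain i where "p = 5 * i + 2 \<or> p = 5 * i + 3"
    unfolding rr_parts_def by blast
  then show "p mod 5 = 2 \<or> p mod 5 = 3" by presburger
qed

lemma prod_rr_parts:
  "(\<Prod>a\<in>rr_parts n. 1 - fps_X ^ a :: rat fps)
   = (\<Prod>i<n. 1 - fps_X ^ (5 * i + 2)) * (\<Prod>i<n. 1 - fps_X ^ (5 * i + 3))"
proof -
  have "5 * i + 2 \<noteq> 5 * j + 3" for i j :: nat by presburger
  then have "(\<lambda>i. 5 * i + 2) ` {..<n} \<inter> (\<lambda>i. 5 * i + 3) ` {..<n} = {}" by blast
  then show ?thesis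
    unfolding rr_parts_def
    by (subst prod.union_disjoint) (auto simp: prod.reindex inj_on_def)
qed

text \<open>Forbidding the part 3 multiplies the generating function by
  \<open>1 - fps_X ^ 3\<close>, and allowing 5 divides it by \<open>1 - fps_X ^ 5\<close>;
  denominators are cleared.\<close>

lemma gf_restricted_parts:
  assumes "0 < n"
  shows "(\<Prod>a\<in>rr_parts n. 1 - fps_X ^ a) * (1 - fps_X ^ 5) * gf (bags (insert 5 (rr_parts n - {3})))
    = 1 - fps_X ^ 3" (is "?W * _ * _ = _")
proof -
  have pos: "rr_parts n \<subseteq> {0<..}" and fin: "finite (rr_parts n)" by (auto simp: rr_parts_def)
  have "5 * i + 2 \<noteq> 5" "5 * i + 3 \<noteq> 5" for i :: nat by presburger+
  then have "5 \<notin> rr_parts n" by (auto simp: rr_parts_def)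
  then have 5: "(1 - fps_X ^ 5) * gf (bags (insert 5 (rr_parts n - {3}))) = gf (bags (rr_parts n - {3}))"
    using pos by (intro gf_bags_insert) auto
  have "3 \<in> rr_parts n" using assms by (force simp: rr_parts_def)
  then have 3: "(1 - fps_X ^ 3) * gf (bags (rr_parts n)) = gf (bags (rr_parts n - {3}))"
    using gf_bags_insert[of 3 "rr_parts n - {3}"] pos by (simp add: insert_absorb Diff_subset[THEN subset_trans])
  have "?W * (1 - fps_X ^ 5) * gf (bags (insert 5 (rr_parts n - {3}))) = ?W * ((1 - fps_X ^ 3) * gf (bags (rr_parts n)))"
    by (simp only: mult.assoc 5 3)
  also have "\<dots> = (1 - fps_X ^ 3) * (?W * gf (bags (rr_parts n)))"
    by (rule mult.left_commute)
  also have "\<dots> = 1 - fps_X ^ 3"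
    by (simp only: gf_bags[OF fin pos] mult_1_right)
  finally show ?thesis .
qed

text \<open>The three cases read on the columns: the excluded partition \<open>[3]\<close> has
  column multiset \<open>{#1#}\<close>. The value \<open>m = 0\<close> is never admissible.\<close>

definition admissible :: "nat \<Rightarrow> nat multiset \<Rightarrow> bool" where
  "admissible m M \<longleftrightarrow> m = 1 \<and> M \<noteq> {#1#} \<or> m = 2 \<and> count M 1 mod 5 \<in> {1, 2, 4} \<or>
     m \<ge> 3 \<and> count M 3 \<le> count M 2"

definition admissible_gf :: "nat \<Rightarrow> rat fps" where
  "admissible_gf m = gf {M \<in> bags {1..m}. admissible m M}"

lemma gf_singleton: "gf {M} = fps_X ^ \<Sum>\<^sub># M"
proof -
  have "{M} = (+) M ` bags {}" by (auto simp: bags_def)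
  then show ?thesis by (simp only: gf_shift gf_bags_empty mult_1_right)
qed

lemma gf_bags_eq_inverse_qfact: "gf (bags {1..m}) = inverse (qfact fps_X m)"
proof -
  have "qfact fps_X m * gf (bags {1..m}) = 1"
    unfolding qfact_def by (rule gf_bags) auto
  then show ?thesis by (rule fps_inverse_unique[symmetric])
qed

lemma admissible_gf_1: "admissible_gf 1 = inverse (qfact fps_X 1) - fps_X"
proof -
  have "bags {1..1} = {M \<in> bags {1..1}. admissible 1 M} \<union> {{#1#}}"
    by (auto simp: admissible_def bags_def)
  moreover have "gf ({M \<in> bags {1..1}. admissible 1 M} \<union> {{#1#}}) = admissible_gf 1 + gf {{#1#}}"
    unfolding admissible_gf_def by (rule gf_Un) (auto simp: admissible_def bags_def)
  ultimately have "gf (bags {1..1}) = admissible_gf 1 + fps_X"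
    by (simp add: gf_singleton)
  then show ?thesis
    unfolding gf_bags_eq_inverse_qfact by simp
qed

text \<open>The three residues give the numerator, and
  \<open>(1 - fps_X) * inverse (qfact fps_X 2)\<close> counts the multisets of 2's.\<close>

lemma admissible_gf_2:
  "(1 - fps_X ^ 5) * admissible_gf 2
   = (fps_X + fps_X ^ 2 + fps_X ^ 4) * ((1 - fps_X) * inverse (qfact fps_X 2))"
proof -
  have "admissible_gf 2 = gf {M \<in> bags {1..2}. count M 1 mod 5 \<in> {1, 2, 4}}"
    by (simp add: admissible_gf_def admissible_def)
  moreover have "(1 - fps_X ^ (5 * 1)) * gf {M \<in> bags {1..2}. count M 1 mod 5 \<in> {1, 2, 4}}
      = (\<Sum>r\<in>{1, 2, 4}. fps_X ^ (r * 1)) * gf (bags ({1..2} - {1}))"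
    by (rule gf_bags_count_mod) auto
  moreover have "(1 - fps_X ^ 1) * gf (bags (insert 1 ({1..2} - {1}))) = gf (bags ({1..2} - {1}))"
    by (rule gf_bags_insert) auto
  moreover have "insert 1 ({1..2} - {1}) = {1..2 :: nat}" by auto
  ultimately show ?thesis
    unfolding gf_bags_eq_inverse_qfact[symmetric] by (simp add: add.assoc)
qed

lemma admissible_gf_ge_3:
  assumes "3 \<le> m"
  shows "(1 - fps_X ^ 5) * admissible_gf m = (1 - fps_X ^ 3) * inverse (qfact fps_X m)"
proof -
  have "admissible_gf m = gf {M \<in> bags {1..m}. count M 3 \<le> count M 2}"
    using assms by (auto simp: admissible_gf_def admissible_def)
  moreover have "(1 - fps_X ^ (2 + 3)) * gf {M \<in> bags {1..m}. count M 3 \<le> count M 2}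
      = (1 - fps_X ^ 3) * gf (bags {1..m})"
    by (rule gf_bags_count_ge) (use assms in auto)
  ultimately show ?thesis
    unfolding gf_bags_eq_inverse_qfact by simp
qed

text \<open>The terms for \<open>m <= 2\<close> do not match one by one; only their sums do.\<close>

lemma small_terms_identity:
  "(1 - fps_X ^ 5) * (1 + fps_X ^ 2 * admissible_gf 1 + fps_X ^ 6 * admissible_gf 2)
   = (1 - fps_X ^ 3) * (1 + fps_X ^ 2 * inverse (qfact fps_X 1) + fps_X ^ 6 * inverse (qfact fps_X 2))"
proof -
  define X :: "rat fps" where "X = fps_X"
  define p where "p = inverse (qfact X 2)"
  have p1: "inverse (qfact X 1) = (1 - X ^ 2) * p"
    using inverse_qfact_Suc[of 1] by (simp add: X_def p_def eval_nat_numeral)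
  \<comment> \<open>Writing 1 in this way makes every term a multiple of \<open>p\<close>, which
    leaves a polynomial identity.\<close>
  have one: "1 = (1 - X) * (1 - X ^ 2) * p"
    using inverse_qfact_Suc[of 0] p1 by (simp add: X_def mult.assoc)
  have a1: "admissible_gf 1 = (1 - X ^ 2) * p - X * ((1 - X) * (1 - X ^ 2) * p)"
    using admissible_gf_1 p1 one by (simp add: X_def)
  have a2: "(1 - X ^ 5) * admissible_gf 2 = (X + X ^ 2 + X ^ 4) * ((1 - X) * p)"
    using admissible_gf_2 by (simp add: X_def p_def)
  have "(1 - X ^ 5) * (1 + X ^ 2 * admissible_gf 1 + X ^ 6 * admissible_gf 2)
    = (1 - X ^ 5) * (1 + X ^ 2 * admissible_gf 1) + X ^ 6 * ((1 - X ^ 5) * admissible_gf 2)"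
    by (simp add: algebra_simps)
  also have "\<dots> = (1 - X ^ 5) * ((1 - X) * (1 - X ^ 2) * p + X ^ 2 * ((1 - X ^ 2) * p - X * ((1 - X) * (1 - X ^ 2) * p)))
      + X ^ 6 * ((X + X ^ 2 + X ^ 4) * ((1 - X) * p))"
    unfolding a1 a2 one[symmetric] ..
  also have "\<dots> = (1 - X ^ 3) * ((1 - X) * (1 - X ^ 2) * p + X ^ 2 * ((1 - X ^ 2) * p) + X ^ 6 * p)"
    by (simp add: algebra_simps eval_nat_numeral)
  also have "\<dots> = (1 - X ^ 3) * (1 + X ^ 2 * inverse (qfact X 1) + X ^ 6 * p)"
    unfolding p1 one[symmetric] ..
  finally show ?thesis by (simp only: X_def p_def)
qed

text \<open>The summand 1 stands for \<open>m = 0\<close>, which \<open>admissible\<close> leaves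
  out. From \<open>m = 3\<close> on the terms agree one by one.\<close>

lemma admissible_gf_sum:
  assumes "3 \<le> n"
  shows "(1 - fps_X ^ 5) * (1 + (\<Sum>m=1..<n. fps_X ^ (m * (m + 1)) * admissible_gf m))
    = (1 - fps_X ^ 3) * rr_sum n 1"
proof -
  have split: "(\<Sum>m=1..<n. f m) = f 1 + f 2 + (\<Sum>m=3..<n. f m)" for f :: "nat \<Rightarrow> rat fps"
  proof -
    have "{1..<n} = {1, 2} \<union> {3..<n}" using assms by auto
    then show ?thesis by (simp add: sum.union_disjoint add.assoc)
  qed
  have "rr_sum n 1 = (\<Sum>m<n. fps_X ^ (m * (m + 1)) * inverse (qfact fps_X m))"
    by (simp add: rr_sum_def algebra_simps)
  also have "\<dots> = 1 + (\<Sum>m=1..<n. fps_X ^ (m * (m + 1)) * inverse (qfact fps_X m))"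
    using assms by (simp add: lessThan_atLeast0 sum.atLeast_Suc_lessThan)
  finally have rr: "rr_sum n 1 = (1 + fps_X ^ 2 * inverse (qfact fps_X 1) + fps_X ^ 6 * inverse (qfact fps_X 2))
      + (\<Sum>m=3..<n. fps_X ^ (m * (m + 1)) * inverse (qfact fps_X m))"
    unfolding split by (simp add: add.assoc power2_eq_square)
  have large: "(1 - fps_X ^ 5) * (\<Sum>m=3..<n. fps_X ^ (m * (m + 1)) * admissible_gf m)
      = (1 - fps_X ^ 3) * (\<Sum>m=3..<n. fps_X ^ (m * (m + 1)) * inverse (qfact fps_X m))"
    unfolding sum_distrib_left
  proof (intro sum.cong refl)
    fix m assume "m \<in> {3..<n}"
    then have "(1 - fps_X ^ 5) * admissible_gf m = (1 - fps_X ^ 3) * inverse (qfact fps_X m)"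
      by (intro admissible_gf_ge_3) simp
    then show "(1 - fps_X ^ 5) * (fps_X ^ (m * (m + 1)) * admissible_gf m)
        = (1 - fps_X ^ 3) * (fps_X ^ (m * (m + 1)) * inverse (qfact fps_X m))"
      by (simp only: mult.left_commute)
  qed
  have "1 + (\<Sum>m=1..<n. fps_X ^ (m * (m + 1)) * admissible_gf m)
      = (1 + fps_X ^ 2 * admissible_gf 1 + fps_X ^ 6 * admissible_gf 2)
      + (\<Sum>m=3..<n. fps_X ^ (m * (m + 1)) * admissible_gf m)"
    unfolding split by (simp add: add.assoc power2_eq_square)
  then show ?thesis
    by (simp only: distrib_left[of _ "1 + _ + _"] small_terms_identity large rr)
qed

lemma nth_admissible_gf_sum:
  assumes "N < n"
  shows "of_nat (card {xs \<in> partitions_of N. xs \<in> Diff2_star \<and> admissible (length xs) (mset (col_star xs))})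
    = fps_nth (\<Sum>m=1..<n. fps_X ^ (m * (m + 1)) * admissible_gf m) N"
proof -
  let ?D = "\<lambda>m. {xs \<in> partitions_of N. xs \<in> Diff2_star \<and> length xs = m \<and> admissible m (mset (col_star xs))}"
  have len: "length xs < n" if "xs \<in> partitions_of N" for xs
  proof -
    have "\<forall>p\<in>set xs. 0 < p" "sum_list xs = N"
      using that by (auto simp: partitions_of_def is_partition_def)
    moreover have "length xs \<le> sum_list xs" if "\<forall>p\<in>set xs. 0 < p" for xs :: "nat list"
      using that by (induction xs) fastforce+
    ultimately show ?thesis using assms by fastforce
  qed
  have pos: "1 \<le> m" if "admissible m M" for m M
    using that by (auto simp: admissible_def)
  have "{xs \<in> partitions_of N. xs \<in> Diff2_star \<and> admissible (length xs) (mset (col_star xs))}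
      = (\<Union>m\<in>{1..<n}. ?D m)"
    using len pos by auto
  also have "card \<dots> = (\<Sum>m=1..<n. card (?D m))"
    by (rule card_UN_disjoint) (auto intro: finite_subset[OF _ finite_partitions_of])
  finally show ?thesis
    by (simp only: card_Diff2_star of_nat_sum card_shifted_eq_nth_gf admissible_gf_def fps_sum_nth)
qed

text \<open>Only the case of one part needs an argument: rebuilding from the columns
  \<open>{#1#}\<close> gives the single part 1 + 2.\<close>

lemma admissible_col_star_iff:
  assumes "xs \<in> Diff2_star"
  shows "admissible (length xs) (mset (col_star xs)) \<longleftrightarrow>
     length xs = 1 \<and> xs \<noteq> [3]
   \<or> length xs = 2 \<and> count_list (col_star xs) 1 mod 5 \<in> {1, 2, 4}
   \<or> length xs \<ge> 3 \<and> count_list (col_star xs) 2 \<ge> count_list (col_star xs) 3"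
proof -
  have "mset (col_star xs) = {#1#} \<longleftrightarrow> xs = [3]" if "length xs = 1"
  proof
    assume "mset (col_star xs) = {#1#}"
    then have "xs = of_columns 1 {#1#}"
      using of_columns_col_star[OF assms that] by simp
    then show "xs = [3]" by (simp add: of_columns_def tail_count_def)
  qed (simp add: col_star_def conjugate_def)
  then show ?thesis by (auto simp: admissible_def count_mset)
qed

theorem theorem10:
  fixes N :: nat
  assumes "N \<ge> 1"
  shows "card {xs \<in> partitions_of N.
             (\<forall>p\<in>set xs. p = 5 \<or> p mod 5 = 2 \<or> p mod 5 = 3) \<and> 3 \<notin> set xs}
       = card {xs \<in> partitions_of N. xs \<in> Diff2_star \<and>
             (length xs = 1 \<and> xs \<noteq> [3]
            \<or> length xs = 2 \<and> count_list (col_star xs) 1 mod 5 \<in> {1, 2, 4}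
            \<or> length xs \<ge> 3 \<and> count_list (col_star xs) 2 \<ge> count_list (col_star xs) 3)}"
    (is "card ?L = card ?R")
proof -
  \<comment> \<open>Exceeding \<open>N\<close> covers the coefficient in question and all parts;
    \<open>admissible_gf_sum\<close> asks for at least 3.\<close>
  define n where "n = N + 3"
  define A where "A = insert 5 (rr_parts n - {3})"
  define W :: "rat fps" where "W = (\<Prod>a\<in>rr_parts n. 1 - fps_X ^ a)"
  define S where "S = (\<Sum>m=1..<n. fps_X ^ (m * (m + 1)) * admissible_gf m)"
  have "set xs \<subseteq> A \<longleftrightarrow> (\<forall>p\<in>set xs. p = 5 \<or> p mod 5 = 2 \<or> p mod 5 = 3) \<and> 3 \<notin> set xs"
    if "xs \<in> partitions_of N" for xs
  proof -
    have "p < n" if "p \<in> set xs" for p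
      using that \<open>xs \<in> partitions_of N\<close> member_le_sum_list[of p xs] by (auto simp: partitions_of_def n_def)
    then have "p \<in> A \<longleftrightarrow> (p = 5 \<or> p mod 5 = 2 \<or> p mod 5 = 3) \<and> p \<noteq> 3" if "p \<in> set xs" for p
      using that in_rr_parts_iff[of p n] by (auto simp: A_def)
    then show ?thesis by blast
  qed
  then have "?L = {xs \<in> partitions_of N. set xs \<subseteq> A}" by blast
  moreover have "0 \<notin> A" by (auto simp: A_def rr_parts_def)
  ultimately have L: "of_nat (card ?L) = fps_nth (gf (bags A)) N"
    by (simp add: card_partitions_eq_card_bags gf_def)
  have "?R = {xs \<in> partitions_of N. xs \<in> Diff2_star \<and> admissible (length xs) (mset (col_star xs))}"
    using admissible_col_star_iff by blast
  then have R: "of_nat (card ?R) = fps_nth S N"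
    unfolding S_def using nth_admissible_gf_sum[of N n] by (simp add: n_def)
  have "fcong n (W * rr_sum n 1) 1"
    unfolding W_def prod_rr_parts by (rule rogers_ramanujan_2)
  then have "fcong n ((1 - fps_X ^ 3) * (W * rr_sum n 1)) ((1 - fps_X ^ 3) * 1)"
    by (rule fcong_mult_left)
  \<comment> \<open>Both sides of the congruence are brought to the common unit factor
    \<open>W * (1 - fps_X ^ 5)\<close>, which then cancels.\<close>
  moreover have "(1 - fps_X ^ 3) * (W * rr_sum n 1) = W * (1 - fps_X ^ 5) * (1 + S)"
    using admissible_gf_sum[of n] by (simp add: S_def n_def mult.left_commute mult.assoc)
  moreover have "(1 - fps_X ^ 3) * 1 = W * (1 - fps_X ^ 5) * gf (bags A)"
    using gf_restricted_parts[of n] by (simp add: W_def A_def n_def)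
  ultimately have "fcong n (W * (1 - fps_X ^ 5) * (1 + S)) (W * (1 - fps_X ^ 5) * gf (bags A))"
    by (simp only:)
  moreover have "fps_nth (W * (1 - fps_X ^ 5)) 0 \<noteq> 0"
    by (auto simp: W_def fps_nth_prod_0 rr_parts_def)
  ultimately have "fcong n (1 + S) (gf (bags A))"
    by (rule fcong_cancel)
  then have "fps_nth (1 + S) N = fps_nth (gf (bags A)) N"
    by (rule fcong_nth) (simp add: n_def)
  \<comment> \<open>The summand 1 affects only the constant coefficient, and \<open>N\<close> is
    positive.\<close>
  then have "of_nat (card ?R) = (of_nat (card ?L) :: rat)"
    unfolding L R using assms by simp
  then show ?thesis by simp
qed

end
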